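(* Let $w\in S_n$ and $M(w)=\{[w(i),i+n]:1\le i\le n\}$, so that $\Sigma_{M(w)}\subseteq\operatorname{Gr}(n,2n)$. Then the flat limit $\lim_{t\to0}\phi_{t,w}\Sigma_{M(w)}$ contains the diagram variety $X_{D(w)}$ as an irreducible component.
   Context: A rank set is a finite set of intervals $[a_i,b_i]$ of positive integers with distinct left endpoints and distinct right endpoints; for a set $S$, $S(M)$ is the set of intervals of $M$ contained in $S$. The rank variety $\Sigma_M\subseteq\operatorname{Gr}(\#M,m)$ is the closure of $\{V:\dim(V\cap\langle S\cap T\rangle)=\#(S\cap T)(M)\ \forall S,T\in M\}$, $\langle X\rangle$ being the span of standard basis vectors $e_i$, $i\in X$. $\phi_{t,i\to j}$ is the linear map of $\mathbb{C}^{2n}$ sending $e_i\mapsto te_i+(1-t)e_j$ and fixing other $e_p$; $\phi_{t,w}=\phi_{t,n+1\to w(1)}\circ\phi_{t,n+2\to w(2)}\circ\cdots\circ\phi_{t,2n\to w(n)}$. For $t\neq0$ the translates $\phi_{t,w}\Sigma_{M(w)}$ form a flat family and the flat limit is its limit scheme at $t=0$. The diagram of $w$ is $D(w)=\{(i,w(j))\in[n]\times[n]: i<j,\ w(i)>w(j)\}$. For $D\subseteq[k]\times[m-k]$, the diagram variety $X_D\subseteq\operatorname{Gr}(k,m)$ is the closure of $\{\operatorname{rowspan}[A\mid I_k]:A\in M_{k,m-k}(\mathbb{C}),\ A_{ij}=0\text{ for }(i,j)\in D\}$; here $k=n$, $m=2n$. *)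

theory Defs
  imports
    "HOL-Library.Function_Algebras"
    "HOL-Combinatorics.Permutations"
    "HOL-Analysis.Abstract_Topology"
    "Jordan_Normal_Form.Determinant"
begin

section \<open>Linear algebra\<close>

text \<open>
  The space \<open>\<complex>\<^sup>m\<close> is realised inside the complex vector space of all functions
  \<open>nat \<Rightarrow> complex\<close>, as the span of the standard basis vectors with index in \<open>{1..m}\<close>.
\<close>

definition cscale :: "complex \<Rightarrow> (nat \<Rightarrow> complex) \<Rightarrow> (nat \<Rightarrow> complex)" where
  "cscale c v = (\<lambda>i. c * v i)"

global_interpretation cv: vector_space cscale
  by unfold_locales (auto simp: cscale_def algebra_simps fun_eq_iff)

definition basis_vec :: "nat \<Rightarrow> (nat \<Rightarrow> complex)" where
  "basis_vec i = (\<lambda>j. if j = i then 1 else 0)"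

definition coord_span :: "nat set \<Rightarrow> (nat \<Rightarrow> complex) set" where
  "coord_span X = cv.span (basis_vec ` X)"

definition Gr :: "nat \<Rightarrow> nat \<Rightarrow> (nat \<Rightarrow> complex) set set" where
  "Gr k m = {V. cv.subspace V \<and> V \<subseteq> coord_span {1..m} \<and> cv.dim V = k}"


section \<open>The Zariski topology of the Grassmannian\<close>

text \<open>
  Closed subsets of \<open>Gr k m\<close> are the zero loci of homogeneous polynomials in the Pluecker
  coordinates, which are indexed by the \<open>k\<close>-element subsets of \<open>{1..m}\<close>.
  As \<open>\<complex>\<close> is infinite, polynomials are identified with polynomial functions.
\<close>

inductive_set poly_funs :: "'v set \<Rightarrow> (('v \<Rightarrow> complex) \<Rightarrow> complex) set"
  for X :: "'v set" where
  const: "(\<lambda>_. c) \<in> poly_funs X"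
| var: "x \<in> X \<Longrightarrow> (\<lambda>p. p x) \<in> poly_funs X"
| add: "f \<in> poly_funs X \<Longrightarrow> g \<in> poly_funs X \<Longrightarrow> (\<lambda>p. f p + g p) \<in> poly_funs X"
| mult: "f \<in> poly_funs X \<Longrightarrow> g \<in> poly_funs X \<Longrightarrow> (\<lambda>p. f p * g p) \<in> poly_funs X"

definition forms :: "nat \<Rightarrow> nat \<Rightarrow> nat \<Rightarrow> ((nat set \<Rightarrow> complex) \<Rightarrow> complex) set" where
  "forms k m d = {f \<in> poly_funs {I. I \<subseteq> {1..m} \<and> card I = k}.
     \<forall>c p. f (\<lambda>I. c * p I) = c ^ d * f p}"

text \<open>The maximal minor with column set \<open>I\<close> of the matrix with rows \<open>b 1, \<dots>, b k\<close>.\<close>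

definition pluecker :: "nat \<Rightarrow> (nat \<Rightarrow> nat \<Rightarrow> complex) \<Rightarrow> nat set \<Rightarrow> complex" where
  "pluecker k b I = det (mat k k (\<lambda>(r, c). b (Suc r) (sorted_list_of_set I ! c)))"

definition vanishes_at ::
    "nat \<Rightarrow> ((nat set \<Rightarrow> complex) \<Rightarrow> complex) \<Rightarrow> (nat \<Rightarrow> complex) set \<Rightarrow> bool" where
  "vanishes_at k f V \<longleftrightarrow> (\<forall>b. cv.span (b ` {1..k}) = V \<longrightarrow> f (pluecker k b) = 0)"

definition zero_locus ::
    "nat \<Rightarrow> nat \<Rightarrow> ((nat set \<Rightarrow> complex) \<Rightarrow> complex) set \<Rightarrow> (nat \<Rightarrow> complex) set set" where
  "zero_locus k m F = {V \<in> Gr k m. \<forall>f\<in>F. vanishes_at k f V}"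

definition zariski :: "nat \<Rightarrow> nat \<Rightarrow> (nat \<Rightarrow> complex) set topology" where
  "zariski k m = topology (\<lambda>U. \<exists>F \<subseteq> (\<Union>d. forms k m d). U = Gr k m - zero_locus k m F)"

lemma forms_mult:
  assumes "f \<in> forms k m d" "g \<in> forms k m d'"
  shows "(\<lambda>p. f p * g p) \<in> forms k m (d + d')"
  using assms by (auto simp: forms_def power_add intro: poly_funs.mult)

lemma forms_const: "(\<lambda>_. c) \<in> forms k m 0"
  by (auto simp: forms_def intro: poly_funs.const)

lemma Gr_spanning_family:
  assumes "V \<in> Gr k m"
  obtains b where "cv.span (b ` {1..k}) = V"
proof -
  have V: "cv.subspace V" "V \<subseteq> coord_span {1..m}" "cv.dim V = k"
    using assms by (auto simp: Gr_def)
  obtain B where B: "B \<subseteq> V" "cv.independent B" "V \<subseteq> cv.span B" "card B = cv.dim V"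
    using cv.basis_exists by blast
  have "B \<subseteq> cv.span (basis_vec ` {1..m})"
    using B(1) V(2) by (auto simp: coord_span_def)
  hence "finite B"
    using cv.independent_span_bound[OF _ B(2)] by blast
  then obtain h where "bij_betw h {1..card B} B"
    by (metis ex_bij_betw_nat_finite_1)
  hence "h ` {1..k} = B"
    using B(4) V(3) by (auto simp: bij_betw_def)
  moreover have "cv.span B = V"
    using B(1,3) V(1) by (meson cv.span_minimal subset_antisym)
  ultimately show ?thesis using that by metis
qed

lemma in_span_family:
  assumes "v \<in> cv.span (b ` {1..k})"
  shows "\<exists>a. \<forall>j. v j = (\<Sum>i<k. a i * b (Suc i) j)"
  using assms
proof (induction rule: cv.span_induct_alt)
  case base
  show ?case by (rule exI[of _ "\<lambda>_. 0"]) auto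
next
  case (step c x y)
  from step obtain a where a: "\<And>j. y j = (\<Sum>i<k. a i * b (Suc i) j)" by blast
  from step obtain i where i: "i \<in> {1..k}" "x = b i" by blast
  then obtain i' where i': "i = Suc i'" "i' < k" by (cases i) auto
  have "(cscale c x + y) j = (\<Sum>l<k. (a l + (if l = i' then c else 0)) * b (Suc l) j)" for j
  proof -
    have "(\<Sum>l<k. (a l + (if l = i' then c else 0)) * b (Suc l) j) =
          (\<Sum>l<k. a l * b (Suc l) j) + (\<Sum>l<k. (if l = i' then c * b (Suc l) j else 0))"
      by (subst sum.distrib[symmetric], rule sum.cong) (auto simp: algebra_simps)
    also have "\<dots> = y j + c * b i j" using i' by (simp add: a)
    finally show ?thesis by (simp add: cscale_def i)
  qed
  thus ?case by (intro exI[of _ "\<lambda>l. a l + (if l = i' then c else 0)"]) blast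
qed

lemma pluecker_change_basis:
  assumes "cv.span (b ` {1..k}) = cv.span (b' ` {1..k})"
  shows "\<exists>c. \<forall>I. pluecker k b' I = c * pluecker k b I"
proof -
  have "\<exists>a. \<forall>j. b' (Suc r) j = (\<Sum>i<k. a i * b (Suc i) j)" if "r < k" for r
  proof (rule in_span_family)
    show "b' (Suc r) \<in> cv.span (b ` {1..k})"
      unfolding assms using that by (intro cv.span_base) auto
  qed
  then obtain a where a: "\<And>r j. r < k \<Longrightarrow> b' (Suc r) j = (\<Sum>i<k. a r i * b (Suc i) j)"
    by metis
  have "pluecker k b' I = det (mat k k (\<lambda>(r, i). a r i)) * pluecker k b I" for I
  proof -
    have "mat k k (\<lambda>(r, c). b' (Suc r) (sorted_list_of_set I ! c)) =
          mat k k (\<lambda>(r, i). a r i) * mat k k (\<lambda>(r, c). b (Suc r) (sorted_list_of_set I ! c))"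
      by (rule eq_matI) (auto simp: scalar_prod_def a lessThan_atLeast0)
    thus ?thesis unfolding pluecker_def
      by (simp add: det_mult[of _ k])
  qed
  thus ?thesis by blast
qed

lemma vanishes_at_iff:
  assumes "f \<in> forms k m d" "cv.span (b ` {1..k}) = V"
  shows "vanishes_at k f V \<longleftrightarrow> f (pluecker k b) = 0"
proof
  assume f0: "f (pluecker k b) = 0"
  show "vanishes_at k f V"
    unfolding vanishes_at_def
  proof (intro allI impI)
    fix b' assume "cv.span (b' ` {1..k}) = V"
    then obtain c where "pluecker k b' = (\<lambda>I. c * pluecker k b I)"
      using pluecker_change_basis[of b k b'] assms(2) by auto
    thus "f (pluecker k b') = 0"
      using assms(1) f0 by (simp add: forms_def)
  qed
qed (use assms(2) in \<open>auto simp: vanishes_at_def\<close>)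

lemma vanishes_at_mult:
  assumes "f \<in> forms k m d" "g \<in> forms k m d'" "V \<in> Gr k m"
  shows "vanishes_at k (\<lambda>p. f p * g p) V \<longleftrightarrow> vanishes_at k f V \<or> vanishes_at k g V"
proof -
  obtain b where b: "cv.span (b ` {1..k}) = V" using Gr_spanning_family assms(3) by blast
  show ?thesis
    unfolding vanishes_at_iff[OF assms(1) b] vanishes_at_iff[OF assms(2) b]
      vanishes_at_iff[OF forms_mult[OF assms(1,2)] b] by simp
qed

lemma istopology_zariski:
  "istopology (\<lambda>U. \<exists>F \<subseteq> (\<Union>d. forms k m d). U = Gr k m - zero_locus k m F)"
  unfolding istopology_def
proof (intro conjI allI impI)
  fix S T
  assume "\<exists>F \<subseteq> (\<Union>d. forms k m d). S = Gr k m - zero_locus k m F"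
    and "\<exists>F \<subseteq> (\<Union>d. forms k m d). T = Gr k m - zero_locus k m F"
  then obtain F G where F: "F \<subseteq> (\<Union>d. forms k m d)" "S = Gr k m - zero_locus k m F"
    and G: "G \<subseteq> (\<Union>d. forms k m d)" "T = Gr k m - zero_locus k m G" by blast
  define H where "H = (\<lambda>(f, g). (\<lambda>p. f p * g p)) ` (F \<times> G)"
  have "H \<subseteq> (\<Union>d. forms k m d)"
    unfolding H_def using F(1) G(1) by (fastforce dest: subsetD intro: forms_mult)
  moreover have "S \<inter> T = Gr k m - zero_locus k m H"
  proof -
    have "vanishes_at k (\<lambda>p. f p * g p) V \<longleftrightarrow> vanishes_at k f V \<or> vanishes_at k g V"
      if "f \<in> F" "g \<in> G" "V \<in> Gr k m" for f g V
      using that F(1) G(1) vanishes_at_mult by blast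
    thus ?thesis
      unfolding F(2) G(2) zero_locus_def H_def by auto
  qed
  ultimately show "\<exists>F \<subseteq> (\<Union>d. forms k m d). S \<inter> T = Gr k m - zero_locus k m F" by blast
next
  fix K
  assume "\<forall>U\<in>K. \<exists>F \<subseteq> (\<Union>d. forms k m d). U = Gr k m - zero_locus k m F"
  then obtain F where F: "\<And>U. U \<in> K \<Longrightarrow> F U \<subseteq> (\<Union>d. forms k m d)"
    "\<And>U. U \<in> K \<Longrightarrow> U = Gr k m - zero_locus k m (F U)" by metis
  have "\<Union>K = (\<Union>U\<in>K. Gr k m - zero_locus k m (F U))" using F(2) by auto
  also have "\<dots> = Gr k m - zero_locus k m (\<Union>U\<in>K. F U)"
    by (auto simp: zero_locus_def)
  finally show "\<exists>F \<subseteq> (\<Union>d. forms k m d). \<Union>K = Gr k m - zero_locus k m F"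
    using F(1) by (intro exI[of _ "\<Union>U\<in>K. F U"]) blast
qed

lemma openin_zariski:
  "openin (zariski k m) U \<longleftrightarrow> (\<exists>F \<subseteq> (\<Union>d. forms k m d). U = Gr k m - zero_locus k m F)"
  unfolding zariski_def using istopology_zariski by (simp add: topology_inverse')

lemma topspace_zariski: "topspace (zariski k m) = Gr k m"
proof -
  have "zero_locus k m {\<lambda>_. 1} = {}"
    using Gr_spanning_family by (force simp: zero_locus_def vanishes_at_def)
  hence "openin (zariski k m) (Gr k m)"
    unfolding openin_zariski using forms_const[of 1 k m]
    by (intro exI[of _ "{\<lambda>_. 1}"]) (auto intro: exI[of _ 0])
  thus ?thesis
    unfolding topspace_def openin_zariski by blast
qed

lemma closedin_zariski:
  "closedin (zariski k m) Z \<longleftrightarrow> (\<exists>F \<subseteq> (\<Union>d. forms k m d). Z = zero_locus k m F)"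
proof -
  have "zero_locus k m F \<subseteq> Gr k m" for F by (auto simp: zero_locus_def)
  thus ?thesis
    unfolding closedin_def openin_zariski topspace_zariski by (metis double_diff order_refl Diff_subset)
qed


section \<open>Irreducible components\<close>

definition irreducible_space :: "'a topology \<Rightarrow> bool" where
  "irreducible_space X \<longleftrightarrow> topspace X \<noteq> {} \<and>
     (\<forall>A B. closedin X A \<and> closedin X B \<and> A \<union> B = topspace X \<longrightarrow>
        A = topspace X \<or> B = topspace X)"

definition irreducible_component_of :: "'a topology \<Rightarrow> 'a set \<Rightarrow> bool" where
  "irreducible_component_of X C \<longleftrightarrow>
     C \<subseteq> topspace X \<and> irreducible_space (subtopology X C) \<and>
     (\<forall>C'. C \<subseteq> C' \<and> C' \<subseteq> topspace X \<and> irreducible_space (subtopology X C') \<longrightarrow> C' = C)"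


section \<open>Flat limits\<close>

text \<open>
  A closed subscheme of \<open>Gr k m\<close> is represented by (the homogeneous elements of) a homogeneous
  ideal in the Pluecker coordinates; its underlying space is the zero locus.
\<close>

definition scheme_space ::
    "nat \<Rightarrow> nat \<Rightarrow> ((nat set \<Rightarrow> complex) \<Rightarrow> complex) set \<Rightarrow> (nat \<Rightarrow> complex) set topology" where
  "scheme_space k m J = subtopology (zariski k m) (zero_locus k m J)"

text \<open>
  Degree \<open>d\<close> forms in the Pluecker coordinates with coefficients polynomial in \<open>t\<close>,
  i.e. elements of \<open>\<complex>[t] \<otimes> forms k m d\<close>.
\<close>

definition family_forms ::
    "nat \<Rightarrow> nat \<Rightarrow> nat \<Rightarrow> (complex \<Rightarrow> (nat set \<Rightarrow> complex) \<Rightarrow> complex) set" where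
  "family_forms k m d = {f. \<exists>N g. (\<forall>i\<le>N. g i \<in> forms k m d) \<and>
     f = (\<lambda>t p. \<Sum>i\<le>N. t ^ i * g i p)}"

text \<open>
  The flat limit of a family \<open>X t\<close> (\<open>t \<noteq> 0\<close>) of subvarieties of \<open>Gr k m\<close> is the fibre at \<open>t = 0\<close>
  of the closure in \<open>\<complex> \<times> Gr k m\<close> of the total space over \<open>\<complex> - {0}\<close>: its ideal consists of the
  specialisations at \<open>t = 0\<close> of the forms vanishing on \<open>X t\<close> for all \<open>t \<noteq> 0\<close>.
\<close>

definition flat_limit ::
    "nat \<Rightarrow> nat \<Rightarrow> (complex \<Rightarrow> (nat \<Rightarrow> complex) set set) \<Rightarrow>
     ((nat set \<Rightarrow> complex) \<Rightarrow> complex) set" where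
  "flat_limit k m X =
     (\<Union>d. {f 0 | f. f \<in> family_forms k m d \<and> (\<forall>t. t \<noteq> 0 \<longrightarrow> (\<forall>V\<in>X t. vanishes_at k (f t) V))})"


section \<open>Rank varieties and diagram varieties\<close>

definition rank_set :: "nat set set \<Rightarrow> bool" where
  "rank_set M \<longleftrightarrow> finite M \<and> (\<forall>S\<in>M. \<exists>a b. 1 \<le> a \<and> a \<le> b \<and> S = {a..b}) \<and>
     inj_on Min M \<and> inj_on Max M"

definition rank_variety :: "nat \<Rightarrow> nat set set \<Rightarrow> (nat \<Rightarrow> complex) set set" where
  "rank_variety m M = zariski (card M) m closure_of
     {V \<in> Gr (card M) m. \<forall>S\<in>M. \<forall>T\<in>M.
        cv.dim (V \<inter> coord_span (S \<inter> T)) = card {R \<in> M. R \<subseteq> S \<inter> T}}"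

definition perm_rank_set :: "nat \<Rightarrow> (nat \<Rightarrow> nat) \<Rightarrow> nat set set" where
  "perm_rank_set n w = {{w i..i + n} | i. i \<in> {1..n}}"

text \<open>The row space of \<open>[A | I\<^sub>k]\<close>, where only the entries \<open>A i j\<close> with
  \<open>i \<in> {1..k}\<close> and \<open>j \<in> {1..m - k}\<close> matter.\<close>

definition rowspan_aug :: "nat \<Rightarrow> nat \<Rightarrow> (nat \<Rightarrow> nat \<Rightarrow> complex) \<Rightarrow> (nat \<Rightarrow> complex) set" where
  "rowspan_aug k m A = cv.span
     ((\<lambda>i j. if j \<in> {1..m - k} then A i j else if j = m - k + i then 1 else 0) ` {1..k})"

definition diagram_variety :: "nat \<Rightarrow> nat \<Rightarrow> (nat \<times> nat) set \<Rightarrow> (nat \<Rightarrow> complex) set set" where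
  "diagram_variety k m D = zariski k m closure_of
     {rowspan_aug k m A | A. \<forall>(i, j)\<in>D. A i j = 0}"

definition perm_diagram :: "nat \<Rightarrow> (nat \<Rightarrow> nat) \<Rightarrow> (nat \<times> nat) set" where
  "perm_diagram n w = {(i, w j) | i j. i \<in> {1..n} \<and> j \<in> {1..n} \<and> i < j \<and> w i > w j}"

definition shift_map :: "complex \<Rightarrow> nat \<Rightarrow> nat \<Rightarrow> (nat \<Rightarrow> complex) \<Rightarrow> (nat \<Rightarrow> complex)" where
  "shift_map t i j v =
     v(i := 0) + cscale (v i) (cscale t (basis_vec i) + cscale (1 - t) (basis_vec j))"

definition perm_shift_map ::
    "nat \<Rightarrow> complex \<Rightarrow> (nat \<Rightarrow> nat) \<Rightarrow> (nat \<Rightarrow> complex) \<Rightarrow> (nat \<Rightarrow> complex)" where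
  "perm_shift_map n t w = foldr (\<circ>) (map (\<lambda>i. shift_map t (n + i) (w i)) [1..<n + 1]) id"

lemma linear_shift_map: "Vector_Spaces.linear cscale cscale (shift_map t i j)"
  by unfold_locales (auto simp: shift_map_def cscale_def algebra_simps fun_eq_iff)

lemma shift_map_basis_vec:
  "shift_map t i j (basis_vec p) =
     (if p = i then cscale t (basis_vec i) + cscale (1 - t) (basis_vec j) else basis_vec p)"
  by (auto simp: shift_map_def cscale_def basis_vec_def fun_eq_iff)

lemma
  assumes "w permutes {1..n}"
  shows rank_set_perm_rank_set: "rank_set (perm_rank_set n w)"
    and card_perm_rank_set: "card (perm_rank_set n w) = n"
proof -
  have eq: "perm_rank_set n w = (\<lambda>i. {w i..i + n}) ` {1..n}"
    by (auto simp: perm_rank_set_def)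
  have w: "w i \<in> {1..n}" if "i \<in> {1..n}" for i
    using permutes_in_image[OF assms, of i] that by simp
  have bounds: "1 \<le> w i" "w i \<le> i + n" if "i \<in> {1..n}" for i
    using w[OF that] by auto
  have Min: "Min {w i..i + n} = w i" and Max: "Max {w i..i + n} = i + n" if "i \<in> {1..n}" for i
    using bounds(2)[OF that] by (auto intro!: Min_eqI Max_eqI)
  have inj: "inj_on (\<lambda>i. {w i..i + n}) {1..n}"
    by (rule inj_on_imageI2[of Max]) (auto simp: inj_on_def Max)
  show "card (perm_rank_set n w) = n"
    unfolding eq using card_image[OF inj] by simp
  have "inj w" using assms by (rule permutes_inj)
  hence "inj_on Min (perm_rank_set n w)" "inj_on Max (perm_rank_set n w)"
    unfolding eq by (auto simp: inj_on_def Min Max dest: injD)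
  thus "rank_set (perm_rank_set n w)"
    unfolding rank_set_def using bounds by (auto simp: eq)
qed

end

theory Submission
  imports Defs
begin

text \<open>
  On the chart of row spaces of \<open>[A | I]\<close>, the flat limit and the diagram variety coincide; since
  the diagram variety is the closure of an affine space in this chart, it is an irreducible
  component.

  Let \<open>P\<close> be the permutation matrix of \<open>w\<close>. The map \<open>\<phi>\<^bsub>t,w\<^esub>\<close> sends the row space of \<open>[A | I]\<close> to
  that of \<open>[A' | I]\<close> with \<open>t A' = A + (1 - t) P\<close>. If the former lies in the rank variety, then for
  \<open>(i, j)\<close> in the diagram and \<open>K = {k \<le> i. w(k) \<le> w(i)}\<close> the rank condition for the interval
  \<open>[w(i), n + i]\<close> forces the minor of \<open>A = t A' - (1 - t) P\<close> with rows \<open>K\<close> and columns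
  \<open>w(K - {i}) \<union> {j}\<close> to vanish. Its column \<open>j\<close> is divisible by \<open>t\<close>, and after dividing, the minor
  specialises at \<open>t = 0\<close> to \<open>\<plusminus> A'\<^sub>i\<^sub>j\<close>. Thus the flat limit satisfies the equations of the diagram
  variety. Conversely, every point of the chart of the diagram variety is the limit of an explicit
  polynomial curve \<open>\<phi>\<^bsub>t,w\<^esub> V\<^sub>t\<close>, where \<open>V\<^sub>t\<close> is spanned by vectors supported on the intervals
  \<open>[w(i), n + i]\<close> and therefore lies in the rank variety.
\<close>

section \<open>Principal minors\<close>

definition principal_minor :: "'i :: linorder set \<Rightarrow> ('i \<Rightarrow> 'i \<Rightarrow> 'a :: comm_ring_1) \<Rightarrow> 'a" where
  "principal_minor K f = det (mat (card K) (card K)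
     (\<lambda>(r, c). f (sorted_list_of_set K ! r) (sorted_list_of_set K ! c)))"

lemma nth_sorted_list_of_set_in: "r < card K \<Longrightarrow> sorted_list_of_set K ! r \<in> K"
  by (metis card_gt_0_iff not_less_zero nat_neq_iff nth_mem set_sorted_list_of_set
      length_sorted_list_of_set)

lemma bij_betw_nth_sorted_list_of_set:
  "finite K \<Longrightarrow> bij_betw ((!) (sorted_list_of_set K)) {0..<card K} K"
  by (rule bij_betw_nth) auto

lemma principal_minor_cong:
  assumes "\<And>i j. i \<in> K \<Longrightarrow> j \<in> K \<Longrightarrow> f i j = g i j"
  shows "principal_minor K f = principal_minor K g"
  unfolding principal_minor_def
  by (intro arg_cong[where f = det] cong_mat) (auto simp: assms nth_sorted_list_of_set_in)

lemma principal_minor_leibniz: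
  fixes f :: "'i :: linorder \<Rightarrow> 'i \<Rightarrow> 'a :: comm_ring_1"
  shows "principal_minor K f = (\<Sum>\<pi> | \<pi> permutes {0..<card K}. signof \<pi> *
     (\<Prod>r = 0..<card K. f (sorted_list_of_set K ! r) (sorted_list_of_set K ! \<pi> r)))"
proof -
  have "(\<Prod>r = 0..<n. mat n n h $$ (r, \<pi> r)) = (\<Prod>r = 0..<n. h (r, \<pi> r))"
    if "\<pi> permutes {0..<n}" for \<pi> n and h :: "nat \<times> nat \<Rightarrow> 'a"
    using permutes_in_image[OF that] by (intro prod.cong) auto
  thus ?thesis by (simp add: principal_minor_def det_def'[of _ "card K"])
qed

lemma principal_minor_transpose: "principal_minor K (\<lambda>i j. f j i) = principal_minor K f"
proof -
  let ?e = "(!) (sorted_list_of_set K)" and ?n = "card K"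
  have "mat ?n ?n (\<lambda>(r, c). f (?e c) (?e r)) = transpose_mat (mat ?n ?n (\<lambda>(r, c). f (?e r) (?e c)))"
    by (rule eq_matI) auto
  thus ?thesis unfolding principal_minor_def by (simp only: det_transpose[OF mat_carrier])
qed

lemma principal_minor_scale_columns:
  assumes "finite K"
  shows "principal_minor K (\<lambda>i j. f i j * s j) = principal_minor K f * (\<Prod>j\<in>K. s j)"
proof -
  let ?e = "(!) (sorted_list_of_set K)"
  have "(\<Prod>r = 0..<card K. s (?e (\<pi> r))) = (\<Prod>j\<in>K. s j)" if "\<pi> permutes {0..<card K}" for \<pi>
    using prod.permute[OF that, of "s \<circ> ?e"]
      prod.reindex_bij_betw[OF bij_betw_nth_sorted_list_of_set[OF assms], of s] by (simp add: o_def)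
  thus ?thesis
    by (simp add: principal_minor_leibniz prod.distrib sum_distrib_right mult.assoc)
qed

lemma principal_minor_upper_triangular:
  assumes "finite K" "\<And>i j. i \<in> K \<Longrightarrow> j \<in> K \<Longrightarrow> j < i \<Longrightarrow> f i j = 0"
  shows "principal_minor K f = (\<Prod>k\<in>K. f k k)"
proof -
  let ?e = "(!) (sorted_list_of_set K)"
  let ?M = "mat (card K) (card K) (\<lambda>(r, c). f (?e r) (?e c))"
  have "?e c < ?e r" if "c < r" "r < card K" for c r
    using that sorted_wrt_nth_less[OF strict_sorted_list_of_set] by simp
  hence "upper_triangular ?M"
    using assms(2) by (intro upper_triangularI) (auto simp: nth_sorted_list_of_set_in)
  hence "principal_minor K f = (\<Prod>r = 0..<card K. f (?e r) (?e r))"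
    unfolding principal_minor_def
    by (simp add: det_upper_triangular[of _ "card K"] prod_list_diag_prod)
  also have "\<dots> = (\<Prod>k\<in>K. f k k)"
    by (rule prod.reindex_bij_betw[OF bij_betw_nth_sorted_list_of_set[OF assms(1)]])
  finally show ?thesis .
qed

lemma principal_minor_replaced_column:
  assumes "finite K" "k \<in> K"
  shows "principal_minor K (\<lambda>i j. if j = k then a i else if i = j then 1 else 0) = a k"
proof -
  let ?e = "(!) (sorted_list_of_set K)" and ?n = "card K"
  have bij: "bij_betw ?e {0..<?n} K" using assms(1) by (rule bij_betw_nth_sorted_list_of_set)
  hence "k \<in> ?e ` {0..<?n}" using assms(2) by (simp only: bij_betw_def)
  then obtain l where l: "l < ?n" "?e l = k" by auto
  have e_eq: "?e r = ?e c \<longleftrightarrow> r = c" if "r < ?n" "c < ?n" for r c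
    using bij that by (auto simp: bij_betw_def dest: inj_onD)
  let ?v = "vec ?n (\<lambda>r. a (?e r))"
  have "mat ?n ?n (\<lambda>(r, c). if ?e c = k then a (?e r) else if ?e r = ?e c then 1 else 0) =
      replace_col (1\<^sub>m ?n) (1\<^sub>m ?n *\<^sub>v ?v) l"
    using l e_eq by (intro eq_matI) (auto simp: replace_col_def)
  hence "principal_minor K (\<lambda>i j. if j = k then a i else if i = j then 1 else 0) =
      ?v $ l * det (1\<^sub>m ?n)"
    unfolding principal_minor_def using l(1) by (simp only:) (rule cramer_lemma_mat, auto)
  thus ?thesis using l by simp
qed

lemma principal_minor_nonzero_imp_inverse:
  fixes f :: "'i :: linorder \<Rightarrow> 'i \<Rightarrow> 'a :: field"
  assumes "finite K" "principal_minor K f \<noteq> 0"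
  obtains g where
    "\<And>i j. i \<in> K \<Longrightarrow> j \<in> K \<Longrightarrow> (\<Sum>k\<in>K. g i k * f k j) = (if i = j then 1 else 0)"
    "\<And>i j. i \<in> K \<Longrightarrow> j \<in> K \<Longrightarrow> (\<Sum>k\<in>K. f i k * g k j) = (if i = j then 1 else 0)"
proof -
  let ?e = "(!) (sorted_list_of_set K)" and ?n = "card K"
  have bij: "bij_betw ?e {0..<?n} K" using assms(1) by (rule bij_betw_nth_sorted_list_of_set)
  define B where "B = mat ?n ?n (\<lambda>(r, c). f (?e r) (?e c))"
  have "B \<in> Units (ring_mat TYPE('a) ?n ())"
    using assms(2) by (intro det_non_zero_imp_unit) (auto simp: B_def principal_minor_def)
  then obtain Y where Y: "Y \<in> carrier_mat ?n ?n" "Y * B = 1\<^sub>m ?n" "B * Y = 1\<^sub>m ?n"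
    unfolding Units_def ring_mat_def by auto
  define idx where "idx = the_inv_into {0..<?n} ?e"
  have e_idx: "?e (idx i) = i" if "i \<in> K" for i
    unfolding idx_def using that by (rule f_the_inv_into_f_bij_betw[OF bij])
  have idx_less: "idx i < ?n" if "i \<in> K" for i
    using bij_betwE[OF bij_betw_the_inv_into[OF bij]] that by (simp add: idx_def)
  have idx_e: "idx (?e r) = r" if "r < ?n" for r
    using bij that by (auto simp: idx_def bij_betw_def the_inv_into_f_f)
  have idx_eq: "idx i = idx j \<longleftrightarrow> i = j" if "i \<in> K" "j \<in> K" for i j
    using e_idx that by metis
  have sum_K: "(\<Sum>k\<in>K. h k) = (\<Sum>r = 0..<?n. h (?e r))" for h :: "'i \<Rightarrow> 'a"
    by (rule sum.reindex_bij_betw[OF bij, symmetric])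
  show ?thesis
  proof (rule that[of "\<lambda>i j. Y $$ (idx i, idx j)"])
    fix i j assume ij: "i \<in> K" "j \<in> K"
    have "(Y * B) $$ (idx i, idx j) = (if i = j then 1 else 0)"
      unfolding Y(2) using ij by (simp add: idx_less idx_eq)
    thus "(\<Sum>k\<in>K. Y $$ (idx i, idx k) * f k j) = (if i = j then 1 else 0)"
      using ij Y(1) by (simp add: sum_K B_def scalar_prod_def idx_less idx_e e_idx)
    have "(B * Y) $$ (idx i, idx j) = (if i = j then 1 else 0)"
      unfolding Y(3) using ij by (simp add: idx_less idx_eq)
    thus "(\<Sum>k\<in>K. f i k * Y $$ (idx k, idx j)) = (if i = j then 1 else 0)"
      using ij Y(1) by (simp add: sum_K B_def scalar_prod_def idx_less idx_e e_idx)
  qed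
qed

lemma principal_minor_nonzero_imp_left_kernel_trivial:
  fixes f :: "'i :: linorder \<Rightarrow> 'i \<Rightarrow> 'a :: field"
  assumes "finite K" "principal_minor K f \<noteq> 0"
    and kernel: "\<And>j. j \<in> K \<Longrightarrow> (\<Sum>k\<in>K. x k * f k j) = 0" and i: "i \<in> K"
  shows "x i = 0"
proof -
  obtain g where g: "\<And>k j. k \<in> K \<Longrightarrow> j \<in> K \<Longrightarrow> (\<Sum>l\<in>K. f k l * g l j) = (if k = j then 1 else 0)"
    using principal_minor_nonzero_imp_inverse[OF assms(1,2)] by metis
  have "x i = (\<Sum>k\<in>K. x k * (if k = i then 1 else 0))"
    using assms(1) i by (simp add: if_distrib[of "(*) _"] cong: if_cong)
  also have "\<dots> = (\<Sum>k\<in>K. \<Sum>l\<in>K. x k * f k l * g l i)"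
    using g i by (intro sum.cong) (simp_all add: sum_distrib_left[symmetric] mult.assoc)
  also have "\<dots> = (\<Sum>l\<in>K. (\<Sum>k\<in>K. x k * f k l) * g l i)"
    by (subst sum.swap) (simp add: sum_distrib_right)
  also have "\<dots> = 0" by (simp add: kernel)
  finally show ?thesis .
qed


section \<open>Polynomial functions\<close>

definition poly_function :: "('a :: comm_ring_1 \<Rightarrow> 'a) \<Rightarrow> bool" where
  "poly_function h \<longleftrightarrow> (\<exists>p. \<forall>s. h s = poly p s)"

lemma poly_function_const: "poly_function (\<lambda>_. c)"
  unfolding poly_function_def by (rule exI[of _ "[:c:]"]) simp

lemma poly_function_id: "poly_function (\<lambda>s. s)"
  unfolding poly_function_def by (rule exI[of _ "[:0, 1:]"]) simp

lemma poly_function_add: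
  "poly_function f \<Longrightarrow> poly_function g \<Longrightarrow> poly_function (\<lambda>s. f s + g s)"
  unfolding poly_function_def by (metis poly_add)

lemma poly_function_diff:
  "poly_function f \<Longrightarrow> poly_function g \<Longrightarrow> poly_function (\<lambda>s. f s - g s)"
  unfolding poly_function_def by (metis poly_diff)

lemma poly_function_mult:
  "poly_function f \<Longrightarrow> poly_function g \<Longrightarrow> poly_function (\<lambda>s. f s * g s)"
  unfolding poly_function_def by (metis poly_mult)

lemma poly_function_power: "poly_function f \<Longrightarrow> poly_function (\<lambda>s. f s ^ N)"
  unfolding poly_function_def by (metis poly_power)

lemma poly_function_sum:
  "(\<And>i. i \<in> S \<Longrightarrow> poly_function (f i)) \<Longrightarrow> poly_function (\<lambda>s. \<Sum>i\<in>S. f i s)"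
  by (induction S rule: infinite_finite_induct) (auto intro: poly_function_const poly_function_add)

lemma poly_function_prod:
  "(\<And>i. i \<in> S \<Longrightarrow> poly_function (f i)) \<Longrightarrow> poly_function (\<lambda>s. \<Prod>i\<in>S. f i s)"
  by (induction S rule: infinite_finite_induct) (auto intro: poly_function_const poly_function_mult)

lemma poly_function_if:
  "poly_function f \<Longrightarrow> poly_function g \<Longrightarrow> poly_function (\<lambda>s. if P then f s else g s)"
  by (cases P) simp_all

lemmas poly_function_intros = poly_function_if poly_function_const poly_function_id
  poly_function_add poly_function_diff poly_function_mult poly_function_power poly_function_sum
  poly_function_prod

lemma poly_function_principal_minor:
  assumes "\<And>i j. i \<in> K \<Longrightarrow> j \<in> K \<Longrightarrow> poly_function (f i j)"
  shows "poly_function (\<lambda>s. principal_minor K (\<lambda>i j. f i j s))"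
  unfolding principal_minor_leibniz
  by (intro poly_function_intros assms nth_sorted_list_of_set_in) (auto dest: permutes_in_image)

lemma poly_function_poly_funs:
  assumes "f \<in> poly_funs X" "\<And>x. x \<in> X \<Longrightarrow> poly_function (\<lambda>s. p s x)"
  shows "poly_function (\<lambda>s. f (p s))"
  using assms by (induction rule: poly_funs.induct) (auto intro: poly_function_intros)

lemma poly_function_eq_0_if_generically_0:
  fixes g h :: "'a :: {idom, ring_char_0} \<Rightarrow> 'a"
  assumes "poly_function g" "poly_function h" "\<And>s. g s \<noteq> 0 \<Longrightarrow> h s = 0" "g s\<^sub>0 \<noteq> 0"
  shows "h s = 0"
proof -
  obtain p q where pq: "\<And>s. g s = poly p s" "\<And>s. h s = poly q s"
    using assms(1,2) unfolding poly_function_def by blast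
  have "poly (p * q) s = 0" for s
    using assms(3)[of s] pq by auto
  hence "p * q = 0" using poly_all_0_iff_0 by blast
  moreover have "p \<noteq> 0" using assms(4) pq(1) by auto
  ultimately show ?thesis using pq(2) by simp
qed


section \<open>Families of vectors\<close>

lemma sum_fun_apply: "(\<Sum>i\<in>S. f i) x = (\<Sum>i\<in>S. f i x)"
  for f :: "'a \<Rightarrow> 'b \<Rightarrow> 'c :: comm_monoid_add"
  by (induction S rule: infinite_finite_induct) auto

lemma span_family_iff:
  assumes "finite J"
  shows "y \<in> cv.span (b ` J) \<longleftrightarrow> (\<exists>x. \<forall>j. y j = (\<Sum>i\<in>J. x i * b i j))"
proof
  assume "y \<in> cv.span (b ` J)"
  thus "\<exists>x. \<forall>j. y j = (\<Sum>i\<in>J. x i * b i j)"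
  proof (induction rule: cv.span_induct_alt)
    case base
    show ?case by (rule exI[of _ "\<lambda>_. 0"]) auto
  next
    case (step c u v)
    then obtain x i where x: "\<And>j. v j = (\<Sum>i\<in>J. x i * b i j)" and i: "i \<in> J" "u = b i" by blast
    have "(cscale c u + v) j = (\<Sum>l\<in>J. (x(i := x i + c)) l * b l j)" for j
      using assms i by (simp add: x cscale_def sum.remove[of J i] algebra_simps)
    thus ?case by blast
  qed
next
  assume "\<exists>x. \<forall>j. y j = (\<Sum>i\<in>J. x i * b i j)"
  then obtain x where "y = (\<Sum>i\<in>J. cscale (x i) (b i))"
    by (auto simp: fun_eq_iff sum_fun_apply cscale_def)
  thus "y \<in> cv.span (b ` J)"
    by (simp add: cv.span_sum cv.span_scale cv.span_base)
qed

lemma span_family_subset: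
  assumes "finite J" "\<And>i j. i \<in> I \<Longrightarrow> a i j = (\<Sum>l\<in>J. y i l * b l j)"
  shows "cv.span (a ` I) \<subseteq> cv.span (b ` J)"
proof (rule cv.span_minimal[OF _ cv.subspace_span], rule image_subsetI)
  fix i assume "i \<in> I"
  thus "a i \<in> cv.span (b ` J)"
    unfolding span_family_iff[OF assms(1)] using assms(2) by blast
qed

lemma span_scaled_family:
  assumes "c \<noteq> 0"
  shows "cv.span ((\<lambda>i. cscale c (b i)) ` J) = cv.span (b ` J)"
proof (rule subset_antisym; rule cv.span_minimal[OF _ cv.subspace_span]; rule image_subsetI)
  fix i assume i: "i \<in> J"
  show "cscale c (b i) \<in> cv.span (b ` J)"
    using i by (intro cv.span_scale cv.span_base) blast
  have "cscale (inverse c) (cscale c (b i)) \<in> cv.span ((\<lambda>i. cscale c (b i)) ` J)"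
    using i by (intro cv.span_scale cv.span_base) blast
  thus "b i \<in> cv.span ((\<lambda>i. cscale c (b i)) ` J)" using assms by simp
qed

lemma coord_span_eq:
  assumes "finite X"
  shows "coord_span X = {v. \<forall>x. x \<notin> X \<longrightarrow> v x = 0}"
proof -
  have "(\<Sum>i\<in>X. a i * basis_vec i j) = (if j \<in> X then a j else 0)" for a j
    using assms by (simp add: basis_vec_def if_distrib[of "(*) _"] cong: if_cong)
  hence "v \<in> coord_span X \<longleftrightarrow> (\<forall>x. x \<notin> X \<longrightarrow> v x = 0)" for v
    unfolding coord_span_def span_family_iff[OF assms] by metis
  thus ?thesis by blast
qed

lemma subspace_coord_span: "cv.subspace (coord_span X)"
  by (simp add: coord_span_def)

definition independent_family :: "'i set \<Rightarrow> ('i \<Rightarrow> nat \<Rightarrow> complex) \<Rightarrow> bool" where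
  "independent_family J b \<longleftrightarrow>
     (\<forall>x. (\<forall>j. (\<Sum>i\<in>J. x i * b i j) = 0) \<longrightarrow> (\<forall>i\<in>J. x i = 0))"

lemma independent_familyD:
  "independent_family J b \<Longrightarrow> (\<And>j. (\<Sum>i\<in>J. x i * b i j) = 0) \<Longrightarrow> i \<in> J \<Longrightarrow> x i = 0"
  unfolding independent_family_def by (drule spec[of _ x]) simp

lemma independent_family_subset:
  assumes "independent_family J b" "finite J" "I \<subseteq> J"
  shows "independent_family I b"
  unfolding independent_family_def
proof (intro allI impI ballI)
  fix x i
  assume x: "\<forall>j. (\<Sum>i\<in>I. x i * b i j) = 0" and i: "i \<in> I"
  have "(\<Sum>i\<in>J. (if i \<in> I then x i else 0) * b i j) = (\<Sum>i\<in>I. x i * b i j)" for j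
    using assms by (intro sum.mono_neutral_cong_right) auto
  hence "(if i \<in> I then x i else 0) = 0"
    using x i assms(3)
    by (intro independent_familyD[OF assms(1), where x = "\<lambda>i. if i \<in> I then x i else 0"]) auto
  thus "x i = 0" using i by simp
qed

lemma independent_family_if_minor_nonzero:
  assumes "finite J" "principal_minor J (\<lambda>i j. b i (e j)) \<noteq> 0"
  shows "independent_family J b"
  unfolding independent_family_def
  using principal_minor_nonzero_imp_left_kernel_trivial[OF assms] by blast

lemma inj_on_independent_family:
  assumes "independent_family J b" "finite J"
  shows "inj_on b J"
proof (rule inj_onI, rule ccontr)
  fix i k assume ik: "i \<in> J" "k \<in> J" "b i = b k" "i \<noteq> k"
  let ?x = "\<lambda>l. (if l = i then 1 else 0) - (if l = k then 1 else 0 :: complex)"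
  have "(\<Sum>l\<in>J. ?x l * b l j) = 0" for j
    using ik assms(2)
    by (simp add: left_diff_distrib sum_subtractf if_distrib[of "\<lambda>c. c * _"] cong: if_cong)
  hence "?x i = 0" by (rule independent_familyD[OF assms(1) _ ik(1)])
  thus False using ik(4) by simp
qed

lemma dim_span_independent_family:
  assumes "independent_family J b" "finite J"
  shows "cv.dim (cv.span (b ` J)) = card J"
proof -
  have inj: "inj_on b J" using assms by (rule inj_on_independent_family)
  have "cv.independent (b ` J)"
  proof
    assume "cv.dependent (b ` J)"
    then obtain u v where u: "v \<in> b ` J" "u v \<noteq> 0" "(\<Sum>v\<in>b ` J. cscale (u v) v) = 0"
      using cv.dependent_finite[of "b ` J"] assms(2) by auto
    have "(\<Sum>i\<in>J. cscale (u (b i)) (b i)) = 0"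
      using u(3) by (simp add: sum.reindex[OF inj])
    hence "(\<Sum>i\<in>J. u (b i) * b i j) = 0" for j
      by (simp add: fun_eq_iff sum_fun_apply cscale_def)
    hence "u (b i) = 0" if "i \<in> J" for i
      using that by (rule independent_familyD[OF assms(1), where x = "\<lambda>i. u (b i)"])
    thus False using u(1,2) by auto
  qed
  hence "cv.dim (cv.span (b ` J)) = card (b ` J)" by (rule cv.dim_span_eq_card_independent)
  thus ?thesis by (simp only: card_image[OF inj])
qed

lemma span_independent_family_in_Gr:
  assumes "independent_family {1..k} b" "\<And>i. i \<in> {1..k} \<Longrightarrow> b i \<in> coord_span {1..m}"
  shows "cv.span (b ` {1..k}) \<in> Gr k m"
proof -
  have "cv.span (b ` {1..k}) \<subseteq> coord_span {1..m}"
    using assms(2) by (intro cv.span_minimal subspace_coord_span) blast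
  moreover have "cv.dim (cv.span (b ` {1..k})) = k"
    using dim_span_independent_family[OF assms(1)] by simp
  ultimately show ?thesis by (simp only: Gr_def mem_Collect_eq cv.subspace_span simp_thms)
qed

lemma dim_le_card_if_determined_by_coords:
  assumes W: "cv.subspace W" and X: "finite X"
    and determined: "\<And>v. v \<in> W \<Longrightarrow> (\<And>x. x \<in> X \<Longrightarrow> v x = 0) \<Longrightarrow> v = 0"
  shows "cv.dim W \<le> card X"
proof -
  define f where "f v = (\<lambda>x. if x \<in> X then v x else 0)" for v :: "nat \<Rightarrow> complex"
  interpret f: Vector_Spaces.linear cscale cscale f
    by unfold_locales (auto simp: f_def cscale_def algebra_simps fun_eq_iff)
  have f_eq_0: "v = 0" if v: "v \<in> W" "f v = 0" for v
  proof (rule determined[OF v(1)])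
    show "v x = 0" if "x \<in> X" for x using fun_cong[OF v(2), of x] that by (simp add: f_def)
  qed
  have inj: "inj_on f W"
    unfolding f.inj_on_iff_eq_0[OF W] using f_eq_0 by blast
  obtain B where B: "B \<subseteq> W" "cv.independent B" "W \<subseteq> cv.span B" "card B = cv.dim W"
    using cv.basis_exists by blast
  have "cv.span B = W" using cv.span_minimal[OF B(1) W] B(3) by (rule subset_antisym)
  hence "cv.independent (f ` B)" using B(2) inj by (intro f.independent_injective_image) simp_all
  moreover have "f ` B \<subseteq> cv.span (basis_vec ` X)"
    unfolding coord_span_def[symmetric] coord_span_eq[OF X] f_def by auto
  ultimately have "card (f ` B) \<le> card (basis_vec ` X)"
    using cv.independent_span_bound[OF finite_imageI[OF X]] by blast
  also have "\<dots> \<le> card X" using X by (rule card_image_le)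
  finally show ?thesis using card_image[OF inj_on_subset[OF inj B(1)]] B(4) by simp
qed


section \<open>Forms and families of forms\<close>

lemma zero_form: "(\<lambda>_. 0) \<in> forms k m d"
  by (auto simp: forms_def intro: poly_funs.const)

lemma forms_add: "f \<in> forms k m d \<Longrightarrow> g \<in> forms k m d \<Longrightarrow> (\<lambda>p. f p + g p) \<in> forms k m d"
  by (auto simp: forms_def algebra_simps intro: poly_funs.add)

lemma forms_sum:
  "(\<And>i. i \<in> S \<Longrightarrow> f i \<in> forms k m d) \<Longrightarrow> (\<lambda>p. \<Sum>i\<in>S. f i p) \<in> forms k m d"
  by (induction S rule: infinite_finite_induct) (auto intro: zero_form forms_add)

lemma forms_cmult: "f \<in> forms k m d \<Longrightarrow> (\<lambda>p. c * f p) \<in> forms k m d"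
  using forms_mult[OF forms_const] by fastforce

lemma forms_power: "f \<in> forms k m d \<Longrightarrow> (\<lambda>p. f p ^ e) \<in> forms k m (e * d)"
  by (induction e) (auto intro: forms_const forms_mult)

lemma forms_var: "I \<subseteq> {1..m} \<Longrightarrow> card I = k \<Longrightarrow> (\<lambda>p. p I) \<in> forms k m 1"
  by (auto simp: forms_def intro: poly_funs.var)

lemma family_forms_specialise: "f \<in> family_forms k m d \<Longrightarrow> f t \<in> forms k m d"
  by (auto simp: family_forms_def intro!: forms_sum forms_cmult)

lemma family_formsE:
  assumes "f \<in> family_forms k m d"
  obtains N g where "\<And>i. i \<le> N \<Longrightarrow> g i \<in> forms k m d" "f = (\<lambda>t p. \<Sum>i\<le>N. t ^ i * g i p)"
  using assms by (auto simp: family_forms_def)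

lemma family_forms_add:
  assumes "f \<in> family_forms k m d" "g \<in> family_forms k m d"
  shows "(\<lambda>t p. f t p + g t p) \<in> family_forms k m d"
proof -
  obtain N F where F: "\<And>i. i \<le> N \<Longrightarrow> F i \<in> forms k m d" "f = (\<lambda>t p. \<Sum>i\<le>N. t ^ i * F i p)"
    using assms(1) by (rule family_formsE) blast
  obtain L H where H: "\<And>i. i \<le> L \<Longrightarrow> H i \<in> forms k m d" "g = (\<lambda>t p. \<Sum>i\<le>L. t ^ i * H i p)"
    using assms(2) by (rule family_formsE) blast
  let ?F = "\<lambda>i p. if i \<le> N then F i p else 0" and ?H = "\<lambda>i p. if i \<le> L then H i p else 0"
  have "?F i \<in> forms k m d" "?H i \<in> forms k m d" for i
    by (cases "i \<le> N"; simp add: F zero_form) (cases "i \<le> L"; simp add: H zero_form)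
  hence "\<forall>i \<le> max N L. (\<lambda>p. ?F i p + ?H i p) \<in> forms k m d"
    by (intro allI impI forms_add)
  moreover have "f t p + g t p = (\<Sum>i\<le>max N L. t ^ i * (?F i p + ?H i p))" for t p
  proof -
    have "f t p = (\<Sum>i\<le>max N L. t ^ i * ?F i p)"
      unfolding F(2) by (rule sum.mono_neutral_cong_left) auto
    moreover have "g t p = (\<Sum>i\<le>max N L. t ^ i * ?H i p)"
      unfolding H(2) by (rule sum.mono_neutral_cong_left) auto
    ultimately show ?thesis by (simp add: sum.distrib ring_distribs)
  qed
  ultimately show ?thesis unfolding family_forms_def
    by (intro CollectI exI[of _ "max N L"] exI[of _ "\<lambda>i p. ?F i p + ?H i p"]) auto
qed

lemma family_forms_monomial:
  assumes "g \<in> forms k m d"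
  shows "(\<lambda>t p. t ^ N * g p) \<in> family_forms k m d"
proof -
  have "(\<lambda>p. if i = N then g p else 0) \<in> forms k m d" for i
    by (cases "i = N") (simp_all add: assms zero_form)
  moreover have "t ^ N * g p = (\<Sum>i\<le>N. t ^ i * (if i = N then g p else 0))" for t p
    by (simp add: if_distrib[of "(*) _"] cong: if_cong)
  ultimately show ?thesis unfolding family_forms_def
    by (intro CollectI exI[of _ N] exI[of _ "\<lambda>i p. if i = N then g p else 0"]) auto
qed

lemma family_forms_const: "g \<in> forms k m d \<Longrightarrow> (\<lambda>t. g) \<in> family_forms k m d"
  using family_forms_monomial[of g k m d 0] by simp

lemma family_forms_sum:
  "(\<And>i. i \<in> S \<Longrightarrow> f i \<in> family_forms k m d) \<Longrightarrow> (\<lambda>t p. \<Sum>i\<in>S. f i t p) \<in> family_forms k m d"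
  by (induction S rule: infinite_finite_induct)
     (auto intro: family_forms_const zero_form family_forms_add)

lemma family_forms_mult:
  assumes "f \<in> family_forms k m d" "g \<in> family_forms k m d'"
  shows "(\<lambda>t p. f t p * g t p) \<in> family_forms k m (d + d')"
proof -
  obtain N F where F: "\<And>i. i \<le> N \<Longrightarrow> F i \<in> forms k m d" "f = (\<lambda>t p. \<Sum>i\<le>N. t ^ i * F i p)"
    using assms(1) by (rule family_formsE) blast
  obtain L H where H: "\<And>i. i \<le> L \<Longrightarrow> H i \<in> forms k m d'" "g = (\<lambda>t p. \<Sum>i\<le>L. t ^ i * H i p)"
    using assms(2) by (rule family_formsE) blast
  have "(\<lambda>t p. f t p * g t p) = (\<lambda>t p. \<Sum>i\<le>N. \<Sum>j\<le>L. t ^ (i + j) * (F i p * H j p))"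
    unfolding F(2) H(2) by (simp add: sum_product power_add mult_ac)
  also have "\<dots> \<in> family_forms k m (d + d')"
    by (intro family_forms_sum family_forms_monomial forms_mult F H) auto
  finally show ?thesis .
qed


section \<open>Polynomial curves in the Grassmannian\<close>

definition polynomial_curve :: "nat \<Rightarrow> (complex \<Rightarrow> nat \<Rightarrow> nat \<Rightarrow> complex) \<Rightarrow> bool" where
  "polynomial_curve k b \<longleftrightarrow> (\<forall>i\<in>{1..k}. \<forall>x. poly_function (\<lambda>s. b s i x))"

lemma sorted_list_of_set_nth_Icc: "c < k \<Longrightarrow> sorted_list_of_set {q + 1..q + k} ! c = q + Suc c"
proof -
  have "sorted_list_of_set {q + 1..q + k} = [q + 1..<q + k + 1]"
    by (metis Suc_eq_plus1 atLeastLessThanSuc_atLeastAtMost sorted_list_of_set_range)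
  thus "c < k \<Longrightarrow> ?thesis" by (simp del: upt_Suc)
qed

lemma principal_minor_interval:
  "principal_minor {1..k} f = det (mat k k (\<lambda>(r, c). f (Suc r) (Suc c)))"
  unfolding principal_minor_def using sorted_list_of_set_nth_Icc[of _ k 0]
  by (intro arg_cong[where f = det] cong_mat) auto

lemma pluecker_eq_principal_minor:
  "pluecker k b I = principal_minor {1..k} (\<lambda>r c. b r (sorted_list_of_set I ! (c - 1)))"
  unfolding pluecker_def principal_minor_interval by simp

lemma poly_function_family_form_along_curve:
  assumes "f \<in> family_forms k m d" "polynomial_curve k b"
  shows "poly_function (\<lambda>s. f s (pluecker k (b s)))"
proof -
  obtain N F where F: "\<And>i. i \<le> N \<Longrightarrow> F i \<in> forms k m d" "f = (\<lambda>t p. \<Sum>i\<le>N. t ^ i * F i p)"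
    using assms(1) by (rule family_formsE) blast
  have "poly_function (\<lambda>s. pluecker k (b s) I)" for I
    unfolding pluecker_eq_principal_minor using assms(2)
    by (intro poly_function_principal_minor) (auto simp: polynomial_curve_def)
  hence "poly_function (\<lambda>s. F i (pluecker k (b s)))" if "i \<le> N" for i
    using F(1)[OF that] by (intro poly_function_poly_funs[where f = "F i"]) (auto simp: forms_def)
  thus ?thesis unfolding F(2) by (intro poly_function_intros) auto
qed

lemma poly_function_form_along_curve:
  "f \<in> forms k m d \<Longrightarrow> polynomial_curve k b \<Longrightarrow> poly_function (\<lambda>s. f (pluecker k (b s)))"
  using poly_function_family_form_along_curve[OF family_forms_const] .

lemma closedin_contains_curve_point:
  assumes T: "closedin (zariski k m) T" and b: "polynomial_curve k b"
    and g: "poly_function g" "g s\<^sub>0 \<noteq> 0"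
    and generic: "\<And>s. g s \<noteq> 0 \<Longrightarrow> cv.span (b s ` {1..k}) \<in> T"
    and Gr: "cv.span (b s\<^sub>1 ` {1..k}) \<in> Gr k m"
  shows "cv.span (b s\<^sub>1 ` {1..k}) \<in> T"
proof -
  obtain F where F: "F \<subseteq> (\<Union>d. forms k m d)" "T = zero_locus k m F"
    using T unfolding closedin_zariski by blast
  have "vanishes_at k f (cv.span (b s\<^sub>1 ` {1..k}))" if f: "f \<in> F" for f
  proof -
    obtain d where d: "f \<in> forms k m d" using f F(1) by blast
    have "f (pluecker k (b s)) = 0" if "g s \<noteq> 0" for s
      using generic[OF that] f by (auto simp: F(2) zero_locus_def vanishes_at_def)
    hence "f (pluecker k (b s\<^sub>1)) = 0"
      by (rule poly_function_eq_0_if_generically_0[OF g(1) poly_function_form_along_curve[OF d b] _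
          g(2)])
    thus ?thesis by (simp only: vanishes_at_iff[OF d refl])
  qed
  thus ?thesis using Gr by (simp add: F(2) zero_locus_def)
qed


section \<open>Irreducibility\<close>

lemma irreducible_space_subtopology_iff:
  assumes "S \<subseteq> topspace X"
  shows "irreducible_space (subtopology X S) \<longleftrightarrow>
    S \<noteq> {} \<and> (\<forall>A B. closedin X A \<and> closedin X B \<and> S \<subseteq> A \<union> B \<longrightarrow> S \<subseteq> A \<or> S \<subseteq> B)"
    (is "?L \<longleftrightarrow> ?R")
proof
  have top: "topspace (subtopology X S) = S" using assms by auto
  show ?R if ?L
  proof (intro conjI allI impI)
    show "S \<noteq> {}" using that unfolding irreducible_space_def top by blast
    fix A B assume AB: "closedin X A \<and> closedin X B \<and> S \<subseteq> A \<union> B"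
    hence "closedin (subtopology X S) (A \<inter> S)" "closedin (subtopology X S) (B \<inter> S)"
      by (auto simp: closedin_subtopology)
    moreover have "(A \<inter> S) \<union> (B \<inter> S) = S" using AB by blast
    ultimately have "A \<inter> S = S \<or> B \<inter> S = S" using that unfolding irreducible_space_def top by blast
    thus "S \<subseteq> A \<or> S \<subseteq> B" by blast
  qed
  show ?L if ?R
    unfolding irreducible_space_def top closedin_subtopology using that by blast
qed

lemma irreducible_space_closure_of:
  assumes "S \<subseteq> topspace X" "irreducible_space (subtopology X S)"
  shows "irreducible_space (subtopology X (X closure_of S))"
proof -
  note irr_iff = irreducible_space_subtopology_iff
  have sub: "S \<subseteq> X closure_of S" using assms(1) by (rule closure_of_subset)
  have "X closure_of S \<subseteq> A \<or> X closure_of S \<subseteq> B"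
    if "closedin X A" "closedin X B" "X closure_of S \<subseteq> A \<union> B" for A B
  proof -
    have "S \<subseteq> A \<or> S \<subseteq> B"
      using assms(2) that sub unfolding irr_iff[OF assms(1)] by blast
    thus ?thesis using that(1,2) closure_of_minimal[of S] by blast
  qed
  moreover have "X closure_of S \<noteq> {}" using assms(2) sub unfolding irr_iff[OF assms(1)] by blast
  ultimately show ?thesis unfolding irr_iff[OF closure_of_subset_topspace] by blast
qed

lemma irreducible_component_if_open_part:
  assumes "L \<subseteq> topspace X" "C \<subseteq> L" "closedin X C" "irreducible_space (subtopology X C)"
    and U: "openin X U" "L \<inter> U \<subseteq> C" "C \<inter> U \<noteq> {}"
  shows "irreducible_component_of (subtopology X L) C"
proof -
  have "C' = C" if C': "C \<subseteq> C'" "C' \<subseteq> L" "irreducible_space (subtopology X C')" for C'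
  proof -
    have "C' \<subseteq> topspace X" using C'(2) assms(1) by blast
    moreover have "closedin X (topspace X - U)" using U(1) by blast
    moreover have "C' \<subseteq> C \<union> (topspace X - U)" using C'(2) U(2) assms(1) by blast
    ultimately have "C' \<subseteq> C \<or> C' \<subseteq> topspace X - U"
      using C'(3) assms(3) irreducible_space_subtopology_iff by metis
    thus ?thesis using C'(1) U(3) by blast
  qed
  moreover have "topspace (subtopology X L) = L" using assms(1) by auto
  moreover have "subtopology (subtopology X L) E = subtopology X E" if "E \<subseteq> L" for E
    using that by (simp add: subtopology_subtopology Int_absorb1)
  ultimately show ?thesis
    unfolding irreducible_component_of_def using assms(2,4) by metis
qed

lemma closedin_zariski_separating_form:
  assumes "closedin (zariski k m) T" "V \<in> Gr k m" "V \<notin> T"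
  obtains f d where "f \<in> forms k m d" "\<not> vanishes_at k f V" "\<And>W. W \<in> T \<Longrightarrow> vanishes_at k f W"
proof -
  obtain F where "F \<subseteq> (\<Union>d. forms k m d)" "T = zero_locus k m F"
    using assms(1) unfolding closedin_zariski by blast
  thus thesis using assms(2,3) that unfolding zero_locus_def by blast
qed

lemma irreducible_space_if_joined_by_curves:
  assumes "S \<subseteq> Gr k m" "S \<noteq> {}"
    and joined: "\<And>V W. V \<in> S \<Longrightarrow> W \<in> S \<Longrightarrow> \<exists>b. polynomial_curve k b \<and>
      cv.span (b 0 ` {1..k}) = V \<and> cv.span (b 1 ` {1..k}) = W \<and> (\<forall>s. cv.span (b s ` {1..k}) \<in> S)"
  shows "irreducible_space (subtopology (zariski k m) S)"
proof -
  have "S \<subseteq> P \<or> S \<subseteq> Q"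
    if PQ: "closedin (zariski k m) P" "closedin (zariski k m) Q" "S \<subseteq> P \<union> Q" for P Q
  proof (rule ccontr)
    assume "\<not> (S \<subseteq> P \<or> S \<subseteq> Q)"
    then obtain V W where V: "V \<in> S" "V \<notin> P" and W: "W \<in> S" "W \<notin> Q" by blast
    obtain f d where f: "f \<in> forms k m d" "\<not> vanishes_at k f V" "\<And>U. U \<in> P \<Longrightarrow> vanishes_at k f U"
      using closedin_zariski_separating_form[OF PQ(1) _ V(2)] V(1) assms(1) by blast
    obtain g e where g: "g \<in> forms k m e" "\<not> vanishes_at k g W" "\<And>U. U \<in> Q \<Longrightarrow> vanishes_at k g U"
      using closedin_zariski_separating_form[OF PQ(2) _ W(2)] W(1) assms(1) by blast
    obtain b where b: "polynomial_curve k b" "cv.span (b 0 ` {1..k}) = V"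
        "cv.span (b 1 ` {1..k}) = W" "\<And>s. cv.span (b s ` {1..k}) \<in> S"
      using joined[OF V(1) W(1)] by blast
    have "g (pluecker k (b s)) = 0" if "f (pluecker k (b s)) \<noteq> 0" for s
    proof -
      have "cv.span (b s ` {1..k}) \<notin> P" using that f(3) unfolding vanishes_at_def by blast
      hence "cv.span (b s ` {1..k}) \<in> Q" using b(4) PQ(3) by blast
      thus ?thesis using g(3) unfolding vanishes_at_def by blast
    qed
    moreover have "f (pluecker k (b 0)) \<noteq> 0" using f(2) vanishes_at_iff[OF f(1) b(2)] by blast
    ultimately have "g (pluecker k (b 1)) = 0"
      by (rule poly_function_eq_0_if_generically_0[OF poly_function_form_along_curve[OF f(1) b(1)]
          poly_function_form_along_curve[OF g(1) b(1)]])
    thus False using g(2) vanishes_at_iff[OF g(1) b(3)] by blast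
  qed
  thus ?thesis
    using assms(1,2) irreducible_space_subtopology_iff[of S "zariski k m"]
    by (simp add: topspace_zariski)
qed

lemma closedin_zero_locus_form:
  "f \<in> forms k m d \<Longrightarrow> closedin (zariski k m) (zero_locus k m {f})"
  unfolding closedin_zariski by (intro exI[of _ "{f}"]) auto

lemma closedin_zero_locus_flat_limit:
  "closedin (zariski k m) (zero_locus k m (flat_limit k m X))"
proof -
  have "flat_limit k m X \<subseteq> (\<Union>d. forms k m d)"
    unfolding flat_limit_def using family_forms_specialise by blast
  thus ?thesis unfolding closedin_zariski by blast
qed


section \<open>The chart of row spaces\<close>

definition right_block :: "nat \<Rightarrow> nat \<Rightarrow> nat set" where
  "right_block k m = {m - k + 1..m}"

definition aug_row :: "nat \<Rightarrow> nat \<Rightarrow> (nat \<Rightarrow> nat \<Rightarrow> complex) \<Rightarrow> nat \<Rightarrow> nat \<Rightarrow> complex" where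
  "aug_row k m A i j = (if j \<in> {1..m - k} then A i j else if j = m - k + i then 1 else 0)"

definition chart :: "nat \<Rightarrow> nat \<Rightarrow> (nat \<Rightarrow> complex) set set" where
  "chart k m = range (rowspan_aug k m)"

lemma rowspan_aug_eq_span: "rowspan_aug k m A = cv.span (aug_row k m A ` {1..k})"
  by (simp only: rowspan_aug_def aug_row_def[abs_def])

lemma sum_aug_row_right_block:
  assumes "r \<in> {1..k}"
  shows "(\<Sum>i = 1..k. x i * aug_row k m A i (m - k + r)) = x r"
proof -
  have "(\<Sum>i = 1..k. x i * aug_row k m A i (m - k + r)) = (\<Sum>i = 1..k. if i = r then x i else 0)"
    using assms by (intro sum.cong) (auto simp: aug_row_def)
  thus ?thesis using assms by simp
qed

lemma rowspan_aug_in_Gr: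
  assumes "k \<le> m"
  shows "rowspan_aug k m A \<in> Gr k m"
  unfolding rowspan_aug_eq_span
proof (rule span_independent_family_in_Gr)
  show "independent_family {1..k} (aug_row k m A)"
    unfolding independent_family_def by (metis sum_aug_row_right_block)
  show "aug_row k m A i \<in> coord_span {1..m}" if "i \<in> {1..k}" for i
    using that assms by (auto simp: coord_span_eq aug_row_def)
qed

lemma right_block_form: "k \<le> m \<Longrightarrow> (\<lambda>p. p (right_block k m)) \<in> forms k m 1"
  by (rule forms_var) (auto simp: right_block_def)

lemma pluecker_right_block:
  assumes "k \<le> m"
  shows "pluecker k b (right_block k m) = principal_minor {1..k} (\<lambda>r c. b r (m - k + c))"
  unfolding pluecker_eq_principal_minor
proof (rule principal_minor_cong)
  fix r c assume "c \<in> {1..k}"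
  hence "c - 1 < k" "Suc (c - 1) = c" by auto
  thus "b r (sorted_list_of_set (right_block k m) ! (c - 1)) = b r (m - k + c)"
    using assms sorted_list_of_set_nth_Icc[of "c - 1" k "m - k"] by (simp add: right_block_def)
qed

lemma pluecker_aug_row_right_block:
  assumes "k \<le> m"
  shows "pluecker k (aug_row k m A) (right_block k m) = 1"
proof -
  have "aug_row k m A r (m - k + c) = (if r = c then 1 else 0)" if "c \<in> {1..k}" for r c
    using that by (auto simp: aug_row_def)
  hence "pluecker k (aug_row k m A) (right_block k m) = (\<Prod>r = 1..k. 1)"
    unfolding pluecker_right_block[OF assms] by (subst principal_minor_upper_triangular) auto
  thus ?thesis by simp
qed

lemma principal_minor_columns_eq_pluecker:
  assumes inj: "inj_on cs {1..k}"
  shows "\<exists>s. \<forall>b. principal_minor {1..k} (\<lambda>r c. b r (cs c)) = s * pluecker k b (cs ` {1..k})"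
proof -
  define L where "L = sorted_list_of_set (cs ` {1..k})"
  define xs where "xs = map (\<lambda>c. cs (Suc c)) [0..<k]"
  have "set xs = cs ` Suc ` {0..<k}" by (simp only: xs_def set_map set_upt image_image)
  also have "Suc ` {0..<k} = {1..k}" by auto
  finally have set_xs: "set xs = cs ` {1..k}" .
  have "card (set xs) = length xs" unfolding set_xs card_image[OF inj] by (simp add: xs_def)
  hence "distinct xs" by (rule card_distinct)
  moreover have "distinct L" "set L = set xs" and len: "length L = k"
    using card_image[OF inj] by (simp_all add: L_def set_xs)
  ultimately have "mset xs = mset L" by (metis set_eq_iff_mset_eq_distinct)
  then obtain \<pi> where \<pi>: "\<pi> permutes {..<k}" "permute_list \<pi> L = xs"
    unfolding len[symmetric] by (rule mset_eq_permutation)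
  have "principal_minor {1..k} (\<lambda>r c. b r (cs c)) = signof \<pi> * pluecker k b (cs ` {1..k})" for b
  proof -
    let ?M = "mat k k (\<lambda>(r, c). b (Suc r) (L ! c))"
    have L_\<pi>: "L ! \<pi> c = cs (Suc c)" if "c < k" for c
      using arg_cong[OF \<pi>(2), of "\<lambda>ys. ys ! c"] that len by (simp add: permute_list_def xs_def)
    have "principal_minor {1..k} (\<lambda>r c. b r (cs c)) =
          det (transpose_mat (mat k k (\<lambda>(r, c). b (Suc r) (cs (Suc c)))))"
      unfolding principal_minor_interval by (rule det_transpose[of _ k, symmetric]) simp
    also have "transpose_mat (mat k k (\<lambda>(r, c). b (Suc r) (cs (Suc c)))) =
               mat k k (\<lambda>(r, c). transpose_mat ?M $$ (\<pi> r, c))"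
      using permutes_in_image[OF \<pi>(1)] L_\<pi> by (intro eq_matI) auto
    also have "det \<dots> = signof \<pi> * det (transpose_mat ?M)"
      using \<pi>(1) by (intro det_permute_rows) (simp_all add: lessThan_atLeast0)
    also have "det (transpose_mat ?M) = det ?M" by (rule det_transpose[of _ k]) simp
    finally show ?thesis by (simp add: pluecker_def L_def)
  qed
  thus ?thesis by blast
qed

lemma matrix_entry_form:
  assumes "r \<in> {1..k}" "j \<in> {1..m - k}"
  shows "\<exists>q \<in> forms k m 1. \<forall>A. q (pluecker k (aug_row k m A)) = A r j"
proof -
  define cs where "cs c = (if c = r then j else m - k + c)" for c
  have inj: "inj_on cs {1..k}"
    using assms by (auto simp: inj_on_def cs_def split: if_splits)
  then obtain s where
      s: "\<And>b. principal_minor {1..k} (\<lambda>r c. b r (cs c)) = s * pluecker k b (cs ` {1..k})"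
    using principal_minor_columns_eq_pluecker by blast
  have "cs ` {1..k} \<subseteq> {1..m}" using assms by (auto simp: cs_def)
  hence "(\<lambda>p. s * p (cs ` {1..k})) \<in> forms k m 1"
    using card_image[OF inj] by (intro forms_cmult forms_var) auto
  moreover have "s * pluecker k (aug_row k m A) (cs ` {1..k}) = A r j" for A
  proof -
    have "s * pluecker k (aug_row k m A) (cs ` {1..k}) =
        principal_minor {1..k} (\<lambda>i c. if c = r then A i j else if i = c then 1 else 0)"
      unfolding s[symmetric] using assms(2)
      by (intro principal_minor_cong) (auto simp: aug_row_def cs_def)
    thus ?thesis using assms(1) principal_minor_replaced_column[of "{1..k}" r "\<lambda>i. A i j"] by simp
  qed
  ultimately show ?thesis by (intro bexI[of _ "\<lambda>p. s * p (cs ` {1..k})"]) auto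
qed

lemma aug_row_eq_if_normalized:
  assumes "k \<le> m" "a l \<in> coord_span {1..m}"
    and normalized: "\<And>c. c \<in> {1..k} \<Longrightarrow> a l (m - k + c) = (if l = c then 1 else 0)"
    and "l \<in> {1..k}"
  shows "aug_row k m a l = a l"
proof
  fix j
  have "a l j = (if j = m - k + l then 1 else 0)" if "j \<notin> {1..m - k}"
  proof (cases "j \<in> {1..m}")
    case True
    hence "j = m - k + (j - (m - k))" "j - (m - k) \<in> {1..k}" using that \<open>k \<le> m\<close> by auto
    thus ?thesis using normalized[of "j - (m - k)"] by auto
  qed (use assms in \<open>auto simp: coord_span_eq\<close>)
  thus "aug_row k m a l j = a l j" by (simp add: aug_row_def)
qed

lemma span_in_chart:
  assumes "k \<le> m" and sub: "cv.span (b ` {1..k}) \<subseteq> coord_span {1..m}"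
    and nz: "pluecker k b (right_block k m) \<noteq> 0"
  shows "cv.span (b ` {1..k}) \<in> chart k m"
proof -
  obtain y where
    left_inverse: "\<And>l c. l \<in> {1..k} \<Longrightarrow> c \<in> {1..k} \<Longrightarrow>
      (\<Sum>r = 1..k. y l r * b r (m - k + c)) = (if l = c then 1 else 0)" and
    right_inverse: "\<And>r s. r \<in> {1..k} \<Longrightarrow> s \<in> {1..k} \<Longrightarrow>
      (\<Sum>l = 1..k. b r (m - k + l) * y l s) = (if r = s then 1 else 0)"
    using principal_minor_nonzero_imp_inverse[OF finite_atLeastAtMost
        nz[unfolded pluecker_right_block[OF assms(1)]]] by blast
  define a where "a l j = (\<Sum>r = 1..k. y l r * b r j)" for l j
  have a_sub: "cv.span (a ` {1..k}) \<subseteq> cv.span (b ` {1..k})"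
    by (rule span_family_subset) (simp_all add: a_def)
  have "aug_row k m a l = a l" if l: "l \<in> {1..k}" for l
  proof (rule aug_row_eq_if_normalized[OF assms(1) _ _ l])
    have "a l \<in> cv.span (a ` {1..k})" using l by (intro cv.span_base) blast
    thus "a l \<in> coord_span {1..m}" using a_sub sub by blast
    show "a l (m - k + c) = (if l = c then 1 else 0)" if "c \<in> {1..k}" for c
      unfolding a_def using l that by (rule left_inverse)
  qed
  hence "aug_row k m a ` {1..k} = a ` {1..k}" by (rule image_cong[OF refl])
  moreover have "cv.span (b ` {1..k}) \<subseteq> cv.span (a ` {1..k})"
  proof (rule span_family_subset)
    fix r j assume r: "r \<in> {1..k}"
    have "(\<Sum>l = 1..k. b r (m - k + l) * a l j) =
        (\<Sum>s = 1..k. (\<Sum>l = 1..k. b r (m - k + l) * y l s) * b s j)"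
      unfolding a_def sum_distrib_left sum_distrib_right by (subst sum.swap) (simp add: mult.assoc)
    also have "\<dots> = (\<Sum>s = 1..k. if s = r then b s j else 0)"
      using right_inverse[OF r] by (intro sum.cong) auto
    finally show "b r j = (\<Sum>l = 1..k. b r (m - k + l) * a l j)" using r by simp
  qed simp
  ultimately have "cv.span (b ` {1..k}) = rowspan_aug k m a"
    using a_sub by (simp add: rowspan_aug_eq_span)
  thus ?thesis by (simp add: chart_def)
qed

lemma openin_chart:
  assumes "k \<le> m"
  shows "openin (zariski k m) (chart k m)"
proof -
  let ?p = "\<lambda>p. p (right_block k m) :: complex"
  have "chart k m = Gr k m - zero_locus k m {?p}"
  proof (intro equalityI subsetI)
    fix V assume "V \<in> chart k m"
    then obtain A where V: "V = rowspan_aug k m A" by (auto simp: chart_def)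
    have "\<not> vanishes_at k ?p V"
      unfolding V vanishes_at_iff[OF right_block_form[OF assms] rowspan_aug_eq_span[symmetric]]
        pluecker_aug_row_right_block[OF assms] by simp
    thus "V \<in> Gr k m - zero_locus k m {?p}"
      using rowspan_aug_in_Gr[OF assms] by (simp add: V zero_locus_def)
  next
    fix V assume V: "V \<in> Gr k m - zero_locus k m {?p}"
    then obtain b where b: "cv.span (b ` {1..k}) = V" "pluecker k b (right_block k m) \<noteq> 0"
      by (auto simp: zero_locus_def vanishes_at_def)
    moreover have "V \<subseteq> coord_span {1..m}" using V by (simp add: Gr_def)
    ultimately show "V \<in> chart k m" using span_in_chart[OF assms, of b] by simp
  qed
  thus ?thesis
    using openin_diff[OF openin_topspace closedin_zero_locus_form[OF right_block_form[OF assms]]]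
    by (simp add: topspace_zariski)
qed

text \<open>The forms are required to vanish outside the chart, so that conditions on them need only be
  checked there.\<close>

definition chart_functions ::
    "nat \<Rightarrow> nat \<Rightarrow> (complex \<Rightarrow> (nat \<Rightarrow> nat \<Rightarrow> complex) \<Rightarrow> complex) set" where
  "chart_functions k m = {F. \<exists>d. \<exists>f\<in>family_forms k m d.
     (\<forall>t A. f t (pluecker k (aug_row k m A)) = F t A) \<and>
     (\<forall>t p. p (right_block k m) = 0 \<longrightarrow> f t p = 0)}"

lemma chart_functionsE:
  assumes "F \<in> chart_functions k m"
  obtains d f where "f \<in> family_forms k m d"
    "\<And>t A. f t (pluecker k (aug_row k m A)) = F t A"
    "\<And>t p. p (right_block k m) = 0 \<Longrightarrow> f t p = 0"
  using assms unfolding chart_functions_def by blast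

lemma chart_functionsI:
  assumes "k \<le> m" "f \<in> family_forms k m d" "\<And>t A. f t (pluecker k (aug_row k m A)) = F t A"
  shows "F \<in> chart_functions k m"
proof -
  have "(\<lambda>t p. p (right_block k m) * f t p) \<in> family_forms k m (1 + d)"
    using assms(1,2) by (intro family_forms_mult family_forms_const right_block_form)
  moreover have "pluecker k (aug_row k m A) (right_block k m) * f t (pluecker k (aug_row k m A)) =
      F t A" for t A
    using assms(1,3) by (simp add: pluecker_aug_row_right_block)
  ultimately show ?thesis
    unfolding chart_functions_def
    by (intro CollectI exI bexI[of _ "\<lambda>t p. p (right_block k m) * f t p"]) auto
qed

lemma chart_functions_const: "k \<le> m \<Longrightarrow> (\<lambda>_ _. c) \<in> chart_functions k m"
  by (rule chart_functionsI[OF _ family_forms_const[OF forms_const]]) auto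

lemma chart_functions_parameter: "k \<le> m \<Longrightarrow> (\<lambda>t _. t) \<in> chart_functions k m"
  by (rule chart_functionsI[OF _ family_forms_monomial[OF forms_const[of 1], where N = 1]]) auto

lemma chart_functions_entry:
  assumes "k \<le> m" "r \<in> {1..k}" "j \<in> {1..m - k}"
  shows "(\<lambda>_ A. A r j) \<in> chart_functions k m"
  using matrix_entry_form[OF assms(2,3)] chart_functionsI[OF assms(1) family_forms_const] by metis

lemma chart_functions_add:
  assumes "k \<le> m" "F \<in> chart_functions k m" "G \<in> chart_functions k m"
  shows "(\<lambda>t A. F t A + G t A) \<in> chart_functions k m"
proof -
  obtain d f where f: "f \<in> family_forms k m d" "\<And>t A. f t (pluecker k (aug_row k m A)) = F t A"
    using assms(2) by (rule chart_functionsE) blast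
  obtain e g where g: "g \<in> family_forms k m e" "\<And>t A. g t (pluecker k (aug_row k m A)) = G t A"
    using assms(3) by (rule chart_functionsE) blast
  let ?p = "\<lambda>p. p (right_block k m) :: complex"
  have raise: "(\<lambda>t p. h t p * ?p p ^ e') \<in> family_forms k m (d' + e')"
    if "h \<in> family_forms k m d'" for h d' e'
    using family_forms_mult[OF that
        family_forms_const[OF forms_power[OF right_block_form[OF assms(1)], of e']]] by simp
  have "(\<lambda>t p. f t p * ?p p ^ e + g t p * ?p p ^ d) \<in> family_forms k m (d + e)"
    using raise[OF f(1), of e] raise[OF g(1), of d]
    by (intro family_forms_add) (simp_all add: add.commute)
  thus ?thesis
    by (rule chart_functionsI[OF assms(1)])
       (simp add: f(2) g(2) pluecker_aug_row_right_block[OF assms(1)])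
qed

lemma chart_functions_mult:
  assumes "k \<le> m" "F \<in> chart_functions k m" "G \<in> chart_functions k m"
  shows "(\<lambda>t A. F t A * G t A) \<in> chart_functions k m"
proof -
  obtain d f where f: "f \<in> family_forms k m d" "\<And>t A. f t (pluecker k (aug_row k m A)) = F t A"
    using assms(2) by (rule chart_functionsE) blast
  obtain e g where g: "g \<in> family_forms k m e" "\<And>t A. g t (pluecker k (aug_row k m A)) = G t A"
    using assms(3) by (rule chart_functionsE) blast
  show ?thesis
    by (rule chart_functionsI[OF assms(1) family_forms_mult[OF f(1) g(1)]]) (simp add: f(2) g(2))
qed

lemma chart_functions_diff:
  assumes "k \<le> m" "F \<in> chart_functions k m" "G \<in> chart_functions k m"
  shows "(\<lambda>t A. F t A - G t A) \<in> chart_functions k m"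
proof -
  have "(\<lambda>t A. F t A + (- 1) * G t A) \<in> chart_functions k m"
    by (intro chart_functions_add chart_functions_mult chart_functions_const assms)
  thus ?thesis by simp
qed

lemma chart_functions_principal_minor:
  assumes "k \<le> m" "\<And>i j. i \<in> K \<Longrightarrow> j \<in> K \<Longrightarrow> F i j \<in> chart_functions k m"
  shows "(\<lambda>t A. principal_minor K (\<lambda>i j. F i j t A)) \<in> chart_functions k m"
proof -
  have sum: "(\<lambda>t A. \<Sum>i\<in>S. G i t A) \<in> chart_functions k m"
    if "\<And>i. i \<in> S \<Longrightarrow> G i \<in> chart_functions k m" for S and G :: "'b \<Rightarrow> _"
    using that by (induction S rule: infinite_finite_induct)
      (auto intro: chart_functions_const chart_functions_add assms(1))
  have prod: "(\<lambda>t A. \<Prod>i\<in>S. G i t A) \<in> chart_functions k m"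
    if "\<And>i. i \<in> S \<Longrightarrow> G i \<in> chart_functions k m" for S and G :: "'b \<Rightarrow> _"
    using that by (induction S rule: infinite_finite_induct)
      (auto intro: chart_functions_const chart_functions_mult assms(1))
  show ?thesis
    unfolding principal_minor_leibniz
    by (intro sum chart_functions_mult chart_functions_const prod assms nth_sorted_list_of_set_in)
      (auto dest: permutes_in_image)
qed

lemma chart_functions_form:
  assumes "k \<le> m" "F \<in> chart_functions k m"
  obtains d f where "f \<in> family_forms k m d"
    "\<And>t V. V \<subseteq> coord_span {1..m} \<Longrightarrow>
      vanishes_at k (f t) V \<longleftrightarrow> (\<forall>A. V = rowspan_aug k m A \<longrightarrow> F t A = 0)"
proof -
  obtain d f where f: "f \<in> family_forms k m d" "\<And>t A. f t (pluecker k (aug_row k m A)) = F t A"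
      "\<And>t p. p (right_block k m) = 0 \<Longrightarrow> f t p = 0"
    using assms(2) by (rule chart_functionsE) blast
  have on_chart: "vanishes_at k (f t) (rowspan_aug k m A) \<longleftrightarrow> F t A = 0" for t A
    unfolding f(2)[symmetric]
    by (rule vanishes_at_iff[OF family_forms_specialise[OF f(1)] rowspan_aug_eq_span[symmetric]])
  show thesis
  proof (rule that[OF f(1)])
    fix t V assume V: "V \<subseteq> coord_span {1..m}"
    show "vanishes_at k (f t) V \<longleftrightarrow> (\<forall>A. V = rowspan_aug k m A \<longrightarrow> F t A = 0)"
    proof (cases "V \<in> chart k m")
      case True
      thus ?thesis using on_chart unfolding chart_def by blast
    next
      case False
      have "f t (pluecker k b) = 0" if "cv.span (b ` {1..k}) = V" for b
        using f(3) span_in_chart[OF assms(1), of b] V False that by blast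
      thus ?thesis using False by (auto simp: vanishes_at_def chart_def)
    qed
  qed
qed


section \<open>Diagram varieties\<close>

definition diagram_cell :: "nat \<Rightarrow> nat \<Rightarrow> (nat \<times> nat) set \<Rightarrow> (nat \<Rightarrow> complex) set set" where
  "diagram_cell k m D = {rowspan_aug k m A | A. \<forall>(i, j)\<in>D. A i j = 0}"

lemma diagram_variety_eq_closure:
  "diagram_variety k m D = zariski k m closure_of diagram_cell k m D"
  by (simp only: diagram_variety_def diagram_cell_def)

lemma diagram_cell_subset_topspace: "k \<le> m \<Longrightarrow> diagram_cell k m D \<subseteq> topspace (zariski k m)"
  using rowspan_aug_in_Gr by (auto simp: diagram_cell_def topspace_zariski)

lemma closedin_diagram_variety: "closedin (zariski k m) (diagram_variety k m D)"
  unfolding diagram_variety_def by (rule closedin_closure_of)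

lemma rowspan_aug_in_diagram_variety:
  assumes "k \<le> m" "\<And>i j. (i, j) \<in> D \<Longrightarrow> A i j = 0"
  shows "rowspan_aug k m A \<in> diagram_variety k m D"
proof -
  have "rowspan_aug k m A \<in> diagram_cell k m D" using assms(2) by (auto simp: diagram_cell_def)
  thus ?thesis
    using closure_of_subset[OF diagram_cell_subset_topspace[OF assms(1)]]
    unfolding diagram_variety_eq_closure by blast
qed

lemma diagram_variety_meets_chart: "k \<le> m \<Longrightarrow> diagram_variety k m D \<inter> chart k m \<noteq> {}"
  using rowspan_aug_in_diagram_variety[of k m D "\<lambda>_ _. 0"] by (auto simp: chart_def)

lemma diagram_variety_subsetI:
  assumes "closedin (zariski k m) T"
    and "\<And>A. (\<And>i j. (i, j) \<in> D \<Longrightarrow> A i j = 0) \<Longrightarrow> rowspan_aug k m A \<in> T"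
  shows "diagram_variety k m D \<subseteq> T"
  unfolding diagram_variety_eq_closure using assms
  by (intro closure_of_minimal) (auto simp: diagram_cell_def)

lemma irreducible_diagram_variety:
  assumes "k \<le> m"
  shows "irreducible_space (subtopology (zariski k m) (diagram_variety k m D))"
  unfolding diagram_variety_eq_closure
proof (rule irreducible_space_closure_of[OF diagram_cell_subset_topspace[OF assms]])
  show "irreducible_space (subtopology (zariski k m) (diagram_cell k m D))"
  proof (rule irreducible_space_if_joined_by_curves)
    show "diagram_cell k m D \<subseteq> Gr k m"
      using diagram_cell_subset_topspace[OF assms] by (simp add: topspace_zariski)
    have "rowspan_aug k m (\<lambda>_ _. 0) \<in> diagram_cell k m D" by (auto simp: diagram_cell_def)
    thus "diagram_cell k m D \<noteq> {}" by blast
  next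
    fix V W assume "V \<in> diagram_cell k m D" "W \<in> diagram_cell k m D"
    then obtain A B where A: "V = rowspan_aug k m A" "\<forall>(i, j)\<in>D. A i j = 0"
      and B: "W = rowspan_aug k m B" "\<forall>(i, j)\<in>D. B i j = 0"
      unfolding diagram_cell_def by blast
    define L where "L s i j = A i j + s * (B i j - A i j)" for s i j
    have "polynomial_curve k (\<lambda>s. aug_row k m (L s))"
      unfolding polynomial_curve_def aug_row_def L_def by (intro ballI allI poly_function_intros)
    moreover have "L 0 = A" "L 1 = B" by (simp_all add: L_def fun_eq_iff)
    moreover have "\<forall>(i, j)\<in>D. L s i j = 0" for s using A(2) B(2) by (fastforce simp: L_def)
    hence "rowspan_aug k m (L s) \<in> diagram_cell k m D" for s unfolding diagram_cell_def by blast
    ultimately show "\<exists>b. polynomial_curve k b \<and> cv.span (b 0 ` {1..k}) = V \<and>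
        cv.span (b 1 ` {1..k}) = W \<and> (\<forall>s. cv.span (b s ` {1..k}) \<in> diagram_cell k m D)"
      unfolding A(1) B(1) rowspan_aug_eq_span
      by (intro exI[of _ "\<lambda>s. aug_row k m (L s)"]) simp
  qed
qed


section \<open>The maps \<open>\<phi>\<^bsub>t,w\<^esub>\<close>\<close>

lemma shift_map_apply:
  "shift_map t i j v x = (if x = i then t * v i else v x) + (if x = j then (1 - t) * v i else 0)"
  by (simp add: shift_map_def cscale_def basis_vec_def algebra_simps)

lemma foldr_shift_map_apply:
  assumes "distinct xs" "inj_on p (set xs)" "p ` set xs \<inter> q ` set xs = {}"
  shows "foldr (\<circ>) (map (\<lambda>i. shift_map t (p i) (q i)) xs) id v x =
    (if x \<in> p ` set xs then t * v x
     else v x + (1 - t) * (\<Sum>i\<in>set xs. if q i = x then v (p i) else 0))"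
  using assms
proof (induction xs arbitrary: x)
  case (Cons a xs)
  let ?u = "foldr (\<circ>) (map (\<lambda>i. shift_map t (p i) (q i)) xs) id v"
  have IH: "?u y = (if y \<in> p ` set xs then t * v y
      else v y + (1 - t) * (\<Sum>i\<in>set xs. if q i = y then v (p i) else 0))" for y
    using Cons.prems by (intro Cons.IH) auto
  have "p a \<notin> p ` set xs" "p a \<notin> q ` set xs" using Cons.prems by auto
  moreover from this(2) have "q i \<noteq> p a" if "i \<in> set xs" for i using that by (metis imageI)
  ultimately have u_pa: "?u (p a) = v (p a)" by (simp add: IH)
  have q: "q a \<noteq> p a" "q a \<notin> p ` set xs" using Cons.prems(3) by auto
  have "foldr (\<circ>) (map (\<lambda>i. shift_map t (p i) (q i)) (a # xs)) id v x =
      (if x = p a then t * v (p a) else ?u x) + (if x = q a then (1 - t) * v (p a) else 0)"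
    using q(1) by (simp add: shift_map_apply u_pa)
  also have "\<dots> = (if x \<in> p ` set (a # xs) then t * v x
      else v x + (1 - t) * (\<Sum>i\<in>set (a # xs). if q i = x then v (p i) else 0))"
    using q Cons.prems(1) by (cases "x = p a"; cases "x = q a") (simp_all add: IH algebra_simps)
  finally show ?case .
qed simp

lemma perm_shift_map_apply:
  assumes "w permutes {1..n}"
  shows "perm_shift_map n t w v x =
    (if x \<in> {1..n} then v x + (1 - t) * v (n + inv_into UNIV w x)
     else if x \<in> {n + 1..2 * n} then t * v x else v x)"
proof -
  have range: "(+) n ` {1..n} = {n + 1..2 * n}" by (simp add: mult_2)
  have "w ` {1..n} = {1..n}" using assms by (rule permutes_image)
  hence "(+) n ` {1..n} \<inter> w ` {1..n} = {}" unfolding range by auto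
  hence "perm_shift_map n t w v x = (if x \<in> {n + 1..2 * n} then t * v x
      else v x + (1 - t) * (\<Sum>i = 1..n. if w i = x then v (n + i) else 0))"
    using foldr_shift_map_apply[of "[1..<n + 1]" "(+) n" w t v x] range
    by (simp add: perm_shift_map_def atLeastLessThanSuc_atLeastAtMost del: upt_Suc)
  moreover have "w i = x \<longleftrightarrow> i = inv_into UNIV w x" for i using permutes_inverses[OF assms] by auto
  moreover have "inv_into UNIV w x \<in> {1..n} \<longleftrightarrow> x \<in> {1..n}"
    by (rule permutes_in_image[OF permutes_inv[OF assms]])
  ultimately show ?thesis by auto
qed

lemma linear_perm_shift_map:
  assumes "w permutes {1..n}"
  shows "Vector_Spaces.linear cscale cscale (perm_shift_map n t w)"
  by unfold_locales
     (auto simp: perm_shift_map_apply[OF assms] cscale_def algebra_simps fun_eq_iff)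

lemma perm_shift_map_span:
  assumes "w permutes {1..n}"
  shows "perm_shift_map n t w ` cv.span (b ` J) = cv.span ((\<lambda>i. perm_shift_map n t w (b i)) ` J)"
proof -
  interpret Vector_Spaces.linear cscale cscale "perm_shift_map n t w"
    using linear_perm_shift_map[OF assms] .
  show ?thesis by (simp add: span_image[symmetric] image_image)
qed

lemma perm_shift_map_coord_span:
  assumes "w permutes {1..n}" "V \<subseteq> coord_span {1..2 * n}"
  shows "perm_shift_map n t w ` V \<subseteq> coord_span {1..2 * n}"
  using assms(2) by (auto simp: coord_span_eq perm_shift_map_apply[OF assms(1)])

lemma inj_perm_shift_map:
  assumes w: "w permutes {1..n}" and "t \<noteq> 0"
  shows "inj (perm_shift_map n t w)"
proof (rule injI)
  fix u v assume eq: "perm_shift_map n t w u = perm_shift_map n t w v"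
  note shifted = fun_cong[OF eq, unfolded perm_shift_map_apply[OF w]]
  have right: "u (n + i) = v (n + i)" if "i \<in> {1..n}" for i
    using shifted[of "n + i"] that \<open>t \<noteq> 0\<close> by auto
  have "inv_into UNIV w x \<in> {1..n}" if "x \<in> {1..n}" for x
    using permutes_in_image[OF permutes_inv[OF w]] that by simp
  hence "u x = v x" for x
    using shifted[of x] right \<open>t \<noteq> 0\<close> by (auto split: if_splits)
  thus "u = v" by blast
qed

definition perm_unshift_map ::
    "nat \<Rightarrow> complex \<Rightarrow> (nat \<Rightarrow> nat) \<Rightarrow> (nat \<Rightarrow> complex) \<Rightarrow> (nat \<Rightarrow> complex)" where
  "perm_unshift_map n t w v x =
     (if x \<in> {1..n} then t * v x - (1 - t) * v (n + inv_into UNIV w x)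
      else if x \<in> {n + 1..2 * n} then v x else t * v x)"

lemma perm_shift_map_unshift:
  assumes w: "w permutes {1..n}"
  shows "perm_shift_map n t w (perm_unshift_map n t w v) = cscale t v"
proof
  fix x
  have "inv_into UNIV w x \<in> {1..n} \<longleftrightarrow> x \<in> {1..n}" by (rule permutes_in_image[OF permutes_inv[OF w]])
  thus "perm_shift_map n t w (perm_unshift_map n t w v) x = cscale t v x"
    by (auto simp: perm_shift_map_apply[OF w] perm_unshift_map_def cscale_def)
qed

definition shift_matrix ::
    "(nat \<Rightarrow> nat) \<Rightarrow> complex \<Rightarrow> (nat \<Rightarrow> nat \<Rightarrow> complex) \<Rightarrow> nat \<Rightarrow> nat \<Rightarrow> complex" where
  "shift_matrix w t A i j = (A i j + (if w i = j then 1 - t else 0)) / t"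

lemma perm_shift_map_rowspan_aug:
  assumes w: "w permutes {1..n}" and "t \<noteq> 0"
  shows "perm_shift_map n t w ` rowspan_aug n (2 * n) A =
    rowspan_aug n (2 * n) (shift_matrix w t A)"
proof -
  have "perm_shift_map n t w (aug_row n (2 * n) A i) =
      cscale t (aug_row n (2 * n) (shift_matrix w t A) i)"
    if i: "i \<in> {1..n}" for i
  proof
    fix x
    have "inv_into UNIV w x \<in> {1..n} \<longleftrightarrow> x \<in> {1..n}"
      by (rule permutes_in_image[OF permutes_inv[OF w]])
    moreover have "inv_into UNIV w x = i \<longleftrightarrow> w i = x" using permutes_inverses[OF w] by metis
    ultimately show "perm_shift_map n t w (aug_row n (2 * n) A i) x =
        cscale t (aug_row n (2 * n) (shift_matrix w t A) i) x"
      using i \<open>t \<noteq> 0\<close>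
      by (auto simp: perm_shift_map_apply[OF w] cscale_def aug_row_def shift_matrix_def)
  qed
  hence "(\<lambda>i. perm_shift_map n t w (aug_row n (2 * n) A i)) ` {1..n} =
      (\<lambda>i. cscale t (aug_row n (2 * n) (shift_matrix w t A) i)) ` {1..n}"
    by (rule image_cong[OF refl])
  thus ?thesis
    by (simp only: rowspan_aug_eq_span perm_shift_map_span[OF w] span_scaled_family[OF \<open>t \<noteq> 0\<close>])
qed

lemma perm_shift_map_image_eq_rowspan_aug:
  assumes w: "w permutes {1..n}" and "t \<noteq> 0"
    and V: "perm_shift_map n t w ` V = rowspan_aug n (2 * n) B"
  obtains A where "V = rowspan_aug n (2 * n) A" "B = shift_matrix w t A"
proof
  let ?A = "\<lambda>i j. t * B i j - (if w i = j then 1 - t else 0)"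
  show B: "B = shift_matrix w t ?A" using \<open>t \<noteq> 0\<close> by (simp add: shift_matrix_def fun_eq_iff)
  have "perm_shift_map n t w ` V = perm_shift_map n t w ` rowspan_aug n (2 * n) ?A"
    by (simp only: V perm_shift_map_rowspan_aug[OF w \<open>t \<noteq> 0\<close>] B[symmetric])
  thus "V = rowspan_aug n (2 * n) ?A"
    using inj_image_eq_iff[OF inj_perm_shift_map[OF w \<open>t \<noteq> 0\<close>]] by blast
qed


section \<open>Generic points of the rank variety\<close>

definition generic_subspaces :: "nat \<Rightarrow> nat set set \<Rightarrow> (nat \<Rightarrow> complex) set set" where
  "generic_subspaces m M = {V \<in> Gr (card M) m. \<forall>S\<in>M. \<forall>T\<in>M.
     cv.dim (V \<inter> coord_span (S \<inter> T)) = card {R \<in> M. R \<subseteq> S \<inter> T}}"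

lemma rank_variety_eq_closure:
  "rank_variety m M = zariski (card M) m closure_of generic_subspaces m M"
  by (simp only: rank_variety_def generic_subspaces_def)

lemma generic_subspaces_subset_rank_variety: "generic_subspaces m M \<subseteq> rank_variety m M"
  unfolding rank_variety_eq_closure
  by (rule closure_of_subset) (auto simp: topspace_zariski generic_subspaces_def)

lemma rank_variety_subset_Gr: "rank_variety m M \<subseteq> Gr (card M) m"
  unfolding rank_variety_eq_closure using closure_of_subset_topspace by (metis topspace_zariski)

lemma vanishes_at_rank_variety:
  assumes f: "f \<in> forms (card M) m d"
    and generic: "\<And>V. V \<in> generic_subspaces m M \<Longrightarrow> vanishes_at (card M) f V"
    and V: "V \<in> rank_variety m M"
  shows "vanishes_at (card M) f V"
proof -
  have "rank_variety m M \<subseteq> zero_locus (card M) m {f}"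
    unfolding rank_variety_eq_closure using generic
    by (intro closure_of_minimal closedin_zero_locus_form[OF f])
       (auto simp: zero_locus_def generic_subspaces_def)
  thus ?thesis using V by (auto simp: zero_locus_def)
qed

definition perm_interval :: "nat \<Rightarrow> (nat \<Rightarrow> nat) \<Rightarrow> nat \<Rightarrow> nat set" where
  "perm_interval n w i = {w i..i + n}"

lemma perm_rank_set_eq_image: "perm_rank_set n w = perm_interval n w ` {1..n}"
  by (auto simp: perm_rank_set_def perm_interval_def)

lemma perm_interval_subset_interval_iff:
  assumes "w permutes {1..n}" "i \<in> {1..n}"
  shows "perm_interval n w i \<subseteq> {a..b} \<longleftrightarrow> a \<le> w i \<and> i + n \<le> b"
  using permutes_in_image[OF assms(1), of i] assms(2) by (auto simp: perm_interval_def)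

lemma inj_on_perm_interval:
  assumes "w permutes {1..n}"
  shows "inj_on (perm_interval n w) {1..n}"
proof (rule inj_onI)
  fix i k assume "i \<in> {1..n}" "k \<in> {1..n}" "perm_interval n w i = perm_interval n w k"
  thus "i = k" using permutes_in_image[OF assms, of i] by (auto simp: perm_interval_def Icc_eq_Icc)
qed

lemma card_perm_rank_subset:
  assumes "w permutes {1..n}"
  shows "card {R \<in> perm_rank_set n w. R \<subseteq> X} = card {i \<in> {1..n}. perm_interval n w i \<subseteq> X}"
proof -
  have "{R \<in> perm_rank_set n w. R \<subseteq> X} = perm_interval n w ` {i \<in> {1..n}. perm_interval n w i \<subseteq> X}"
    by (auto simp: perm_rank_set_eq_image)
  moreover have "inj_on (perm_interval n w) {i \<in> {1..n}. perm_interval n w i \<subseteq> X}"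
    by (rule inj_on_subset[OF inj_on_perm_interval[OF assms]]) auto
  ultimately show ?thesis by (simp only: card_image)
qed

definition supported_families :: "'i set \<Rightarrow> ('i \<Rightarrow> nat set) \<Rightarrow> ('i \<Rightarrow> nat \<Rightarrow> complex) set" where
  "supported_families J R = {v. \<forall>i\<in>J. \<forall>x. x \<notin> R i \<longrightarrow> v i x = 0}"

lemma span_inter_coord_span:
  assumes "finite J" "finite X" and v: "v \<in> supported_families J R"
    and outside: "\<And>i. i \<in> J \<Longrightarrow> \<not> R i \<subseteq> X \<Longrightarrow> e i \<notin> X"
    and nz: "principal_minor {i \<in> J. \<not> R i \<subseteq> X} (\<lambda>i j. v i (e j)) \<noteq> 0"
  shows "cv.span (v ` J) \<inter> coord_span X = cv.span (v ` {i \<in> J. R i \<subseteq> X})"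
proof (intro equalityI subsetI IntI)
  let ?I = "{i \<in> J. R i \<subseteq> X}" and ?K = "{i \<in> J. \<not> R i \<subseteq> X}"
  fix y assume y: "y \<in> cv.span (v ` J) \<inter> coord_span X"
  then obtain x where x: "\<And>c. y c = (\<Sum>i\<in>J. x i * v i c)"
    using span_family_iff[OF assms(1)] by blast
  have "(\<Sum>k\<in>?K. x k * v k (e j)) = 0" if j: "j \<in> ?K" for j
  proof -
    have e_j_outside: "e j \<notin> X" using outside j by blast
    have "(\<Sum>k\<in>?K. x k * v k (e j)) = y (e j)"
      unfolding x using v e_j_outside assms(1)
      by (intro sum.mono_neutral_left) (auto simp: supported_families_def)
    thus ?thesis using y e_j_outside by (simp add: coord_span_eq[OF assms(2)])
  qed
  hence "x i = 0" if "i \<in> ?K" for i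
    using principal_minor_nonzero_imp_left_kernel_trivial[OF _ nz _ that] assms(1) by simp
  hence "y c = (\<Sum>i\<in>?I. x i * v i c)" for c
    unfolding x using assms(1) by (intro sum.mono_neutral_right) auto
  thus "y \<in> cv.span (v ` ?I)" using span_family_iff[of ?I y v] assms(1) by auto
next
  fix y assume y: "y \<in> cv.span (v ` {i \<in> J. R i \<subseteq> X})"
  have "v ` {i \<in> J. R i \<subseteq> X} \<subseteq> coord_span X"
    using v unfolding supported_families_def coord_span_eq[OF assms(2)] by blast
  thus "y \<in> coord_span X" using y cv.span_minimal subspace_coord_span by blast
  show "y \<in> cv.span (v ` J)" using y by (rule subsetD[OF cv.span_mono, rotated]) auto
qed

text \<open>An interval which is not contained in the interval \<open>X\<close> has an endpoint outside \<open>X\<close>, and these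
  endpoints are distinct: they are the columns of the following minor.\<close>

definition boundary_point :: "nat \<Rightarrow> (nat \<Rightarrow> nat) \<Rightarrow> nat set \<Rightarrow> nat \<Rightarrow> nat" where
  "boundary_point n w X i = (if w i \<notin> X then w i else i + n)"

definition boundary_minor ::
    "nat \<Rightarrow> (nat \<Rightarrow> nat) \<Rightarrow> (nat \<Rightarrow> nat \<Rightarrow> complex) \<Rightarrow> nat set \<Rightarrow> complex" where
  "boundary_minor n w v X =
     principal_minor {i \<in> {1..n}. \<not> perm_interval n w i \<subseteq> X} (\<lambda>i j. v i (boundary_point n w X j))"

definition subintervals :: "nat \<Rightarrow> nat set set" where
  "subintervals m = (\<lambda>(a, b). {a..b}) ` ({1..m + 1} \<times> {..m})"

lemma finite_subintervals: "finite (subintervals m)"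
  by (simp add: subintervals_def)

lemma empty_in_subintervals: "{} \<in> subintervals m"
  unfolding subintervals_def by (rule image_eqI[of _ _ "(1, 0)"]) auto

lemma perm_interval_Int_in_subintervals:
  assumes "w permutes {1..n}" "i \<in> {1..n}" "k \<in> {1..n}"
  shows "perm_interval n w i \<inter> perm_interval n w k \<in> subintervals (2 * n)"
  using assms permutes_in_image[OF assms(1), of i] permutes_in_image[OF assms(1), of k]
  unfolding subintervals_def perm_interval_def Int_atLeastAtMost
  by (intro image_eqI[of _ _ "(max (w i) (w k), min (i + n) (k + n))"]) auto

lemma independent_family_if_boundary_minor_nonzero:
  assumes "w permutes {1..n}" "boundary_minor n w v {} \<noteq> 0"
  shows "independent_family {1..n} v"
proof (rule independent_family_if_minor_nonzero[where e = "boundary_point n w {}"])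
  have "w i \<in> perm_interval n w i" if "i \<in> {1..n}" for i
    using permutes_in_image[OF assms(1), of i] that by (auto simp: perm_interval_def)
  hence rows: "{i \<in> {1..n}. \<not> perm_interval n w i \<subseteq> {}} = {1..n}" by blast
  show "principal_minor {1..n} (\<lambda>i j. v i (boundary_point n w {} j)) \<noteq> 0"
    using assms(2) unfolding boundary_minor_def rows .
qed simp

lemma supported_span_in_Gr:
  assumes w: "w permutes {1..n}" and v: "v \<in> supported_families {1..n} (perm_interval n w)"
    and "independent_family {1..n} v"
  shows "cv.span (v ` {1..n}) \<in> Gr n (2 * n)"
proof (rule span_independent_family_in_Gr[OF assms(3)])
  fix i assume i: "i \<in> {1..n}"
  have "perm_interval n w i \<subseteq> {1..2 * n}"
    using permutes_in_image[OF w, of i] i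
    unfolding perm_interval_subset_interval_iff[OF w i] by auto
  thus "v i \<in> coord_span {1..2 * n}"
    using v i unfolding coord_span_eq[OF finite_atLeastAtMost] supported_families_def by blast
qed

lemma supported_span_in_generic_subspaces:
  assumes w: "w permutes {1..n}" and v: "v \<in> supported_families {1..n} (perm_interval n w)"
    and nz: "\<And>X. X \<in> subintervals (2 * n) \<Longrightarrow> boundary_minor n w v X \<noteq> 0"
  shows "cv.span (v ` {1..n}) \<in> generic_subspaces (2 * n) (perm_rank_set n w)"
proof -
  have ind: "independent_family {1..n} v"
    by (rule independent_family_if_boundary_minor_nonzero[OF w nz[OF empty_in_subintervals]])
  have dim: "cv.dim (cv.span (v ` {1..n}) \<inter> coord_span X) = card {R \<in> perm_rank_set n w. R \<subseteq> X}"
    if X: "X \<in> subintervals (2 * n)" for X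
  proof -
    let ?I = "{i \<in> {1..n}. perm_interval n w i \<subseteq> X}"
    obtain a b where ab: "X = {a..b}" using X by (auto simp: subintervals_def)
    have "cv.span (v ` {1..n}) \<inter> coord_span X = cv.span (v ` ?I)"
    proof (rule span_inter_coord_span[OF _ _ v])
      show "principal_minor {i \<in> {1..n}. \<not> perm_interval n w i \<subseteq> X}
          (\<lambda>i j. v i (boundary_point n w X j)) \<noteq> 0"
        using nz[OF X] unfolding boundary_minor_def .
      show "boundary_point n w X i \<notin> X" if "i \<in> {1..n}" "\<not> perm_interval n w i \<subseteq> X" for i
        using that perm_interval_subset_interval_iff[OF w that(1), of a b]
        by (auto simp: ab boundary_point_def)
    qed (simp_all add: ab)
    moreover have "independent_family ?I v" by (rule independent_family_subset[OF ind]) auto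
    ultimately show ?thesis
      by (simp add: dim_span_independent_family card_perm_rank_subset[OF w] del: cv.dim_span)
  qed
  have "cv.span (v ` {1..n}) \<in> Gr (card (perm_rank_set n w)) (2 * n)"
    unfolding card_perm_rank_set[OF w] by (rule supported_span_in_Gr[OF w v ind])
  thus ?thesis
    unfolding generic_subspaces_def using dim perm_interval_Int_in_subintervals[OF w]
    by (auto simp: perm_rank_set_eq_image)
qed

definition endpoint_family :: "nat \<Rightarrow> (nat \<Rightarrow> nat) \<Rightarrow> nat \<Rightarrow> nat \<Rightarrow> complex" where
  "endpoint_family n w i x = (if x = w i \<or> x = i + n then 1 else 0)"

lemma endpoint_family_supported:
  assumes "w permutes {1..n}"
  shows "endpoint_family n w \<in> supported_families {1..n} (perm_interval n w)"
proof -
  have "w i \<le> i + n" if "i \<in> {1..n}" for i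
    using permutes_in_image[OF assms, of i] that by auto
  thus ?thesis by (auto simp: supported_families_def perm_interval_def endpoint_family_def)
qed

lemma boundary_minor_endpoint_family:
  assumes w: "w permutes {1..n}"
  shows "boundary_minor n w (endpoint_family n w) X = 1"
proof -
  have "endpoint_family n w i (boundary_point n w X j) = (if i = j then 1 else 0)"
    if "i \<in> {1..n}" "j \<in> {1..n}" for i j
    using that permutes_in_image[OF w, of i] permutes_in_image[OF w, of j]
      inj_eq[OF permutes_inj[OF w], of i j]
    by (auto simp: endpoint_family_def boundary_point_def)
  thus ?thesis
    unfolding boundary_minor_def
    by (subst principal_minor_upper_triangular) (auto intro: prod.neutral)
qed

text \<open>Joining a supported family to the endpoint family by a line exhibits its span as a limit of
  generic subspaces.\<close>

lemma supported_span_in_rank_variety: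
  assumes w: "w permutes {1..n}" and v: "v \<in> supported_families {1..n} (perm_interval n w)"
    and ind: "independent_family {1..n} v"
  shows "cv.span (v ` {1..n}) \<in> rank_variety (2 * n) (perm_rank_set n w)"
proof -
  define u where "u s i x = v i x + s * (endpoint_family n w i x - v i x)" for s i x
  define g where "g s = (\<Prod>X\<in>subintervals (2 * n). boundary_minor n w (u s) X)" for s
  have u: "u s \<in> supported_families {1..n} (perm_interval n w)" for s
    using v endpoint_family_supported[OF w] by (simp add: supported_families_def u_def)
  have u_ends: "u 0 = v" "u 1 = endpoint_family n w" by (simp_all add: u_def fun_eq_iff)
  have "cv.span (u 0 ` {1..n}) \<in> rank_variety (2 * n) (perm_rank_set n w)"
  proof (rule closedin_contains_curve_point)
    show "closedin (zariski n (2 * n)) (rank_variety (2 * n) (perm_rank_set n w))"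
      unfolding rank_variety_def card_perm_rank_set[OF w] by (rule closedin_closure_of)
    show "polynomial_curve n u"
      unfolding polynomial_curve_def u_def by (intro ballI allI poly_function_intros)
    show "poly_function g"
      unfolding g_def boundary_minor_def u_def
      by (intro poly_function_prod poly_function_principal_minor poly_function_intros)
    show "g 1 \<noteq> 0" by (simp add: g_def u_ends boundary_minor_endpoint_family[OF w])
    show "cv.span (u 0 ` {1..n}) \<in> Gr n (2 * n)"
      unfolding u_ends using w v ind by (rule supported_span_in_Gr)
    fix s assume "g s \<noteq> 0"
    hence "boundary_minor n w (u s) X \<noteq> 0" if "X \<in> subintervals (2 * n)" for X
      using that finite_subintervals by (auto simp: g_def)
    thus "cv.span (u s ` {1..n}) \<in> rank_variety (2 * n) (perm_rank_set n w)"
      using supported_span_in_generic_subspaces[OF w u] generic_subspaces_subset_rank_variety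
      by blast
  qed
  thus ?thesis by (simp only: u_ends)
qed


section \<open>Equations of the flat limit\<close>

definition minor_rows :: "(nat \<Rightarrow> nat) \<Rightarrow> nat \<Rightarrow> nat set" where
  "minor_rows w i = {k \<in> {1..i}. w k \<le> w i}"

text \<open>The minor of \<open>t A - (1 - t) P\<^sub>w\<close> with rows \<open>K = minor_rows w i\<close> and columns
  \<open>w (K - {i}) \<union> {j}\<close>, with the last column divided by \<open>t\<close>; the column \<open>w c\<close> has index \<open>c\<close>, and the
  column \<open>j\<close> has index \<open>i\<close>.\<close>

definition limit_entry ::
    "(nat \<Rightarrow> nat) \<Rightarrow> nat \<Rightarrow> nat \<Rightarrow> complex \<Rightarrow> (nat \<Rightarrow> nat \<Rightarrow> complex) \<Rightarrow> nat \<Rightarrow> nat \<Rightarrow> complex" where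
  "limit_entry w i j t A k c =
     (if c = i then A k j else t * A k (w c) - (if k = c then 1 - t else 0))"

definition limit_minor ::
    "(nat \<Rightarrow> nat) \<Rightarrow> nat \<Rightarrow> nat \<Rightarrow> complex \<Rightarrow> (nat \<Rightarrow> nat \<Rightarrow> complex) \<Rightarrow> complex" where
  "limit_minor w i j t A = principal_minor (minor_rows w i) (limit_entry w i j t A)"

lemma finite_minor_rows: "finite (minor_rows w i)"
  by (simp add: minor_rows_def)

lemma limit_minor_chart_function:
  assumes "w permutes {1..n}" "i \<in> {1..n}" "j \<in> {1..n}"
  shows "limit_minor w i j \<in> chart_functions n (2 * n)"
proof -
  have n_le_2n: "n \<le> 2 * n" by simp
  note intros = chart_functions_diff[OF n_le_2n] chart_functions_mult[OF n_le_2n]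
    chart_functions_parameter[OF n_le_2n] chart_functions_const[OF n_le_2n]
    chart_functions_entry[OF n_le_2n]
  have "(\<lambda>t A. limit_entry w i j t A k c) \<in> chart_functions n (2 * n)"
    if "k \<in> minor_rows w i" "c \<in> minor_rows w i" for k c
  proof -
    have "k \<in> {1..n}" "w c \<in> {1..n}"
      using that assms permutes_in_image[OF assms(1), of c] by (auto simp: minor_rows_def)
    thus ?thesis
      using assms(3) unfolding limit_entry_def
      by (cases "c = i"; cases "k = c") (auto intro!: intros)
  qed
  thus ?thesis
    unfolding limit_minor_def[abs_def] by (rule chart_functions_principal_minor[OF n_le_2n])
qed

lemma limit_minor_shift_matrix:
  assumes w: "w permutes {1..n}" and "t \<noteq> 0" and ij: "(i, j) \<in> perm_diagram n w"
  shows "limit_minor w i j t (shift_matrix w t A) = limit_minor w i j 1 A / t"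
proof -
  note w_eq_iff = inj_eq[OF permutes_inj[OF w]]
  have i: "i \<in> minor_rows w i" and w_neq: "\<And>k. k \<in> minor_rows w i \<Longrightarrow> w k \<noteq> j"
    using ij by (auto simp: perm_diagram_def minor_rows_def w_eq_iff)
  have "limit_minor w i j t (shift_matrix w t A) = principal_minor (minor_rows w i)
      (\<lambda>k c. limit_entry w i j 1 A k c * (if c = i then 1 / t else 1))"
    unfolding limit_minor_def using w_neq \<open>t \<noteq> 0\<close>
    by (intro principal_minor_cong) (auto simp: limit_entry_def shift_matrix_def w_eq_iff)
  also have "\<dots> = limit_minor w i j 1 A * (\<Prod>c\<in>minor_rows w i. if c = i then 1 / t else 1)"
    unfolding limit_minor_def by (rule principal_minor_scale_columns[OF finite_minor_rows])
  also have "(\<Prod>c\<in>minor_rows w i. if c = i then 1 / t else 1) = 1 / t"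
    using i finite_minor_rows by simp
  finally show ?thesis by simp
qed

lemma limit_minor_0_eq_0_iff:
  assumes "1 \<le> i"
  shows "limit_minor w i j 0 A = 0 \<longleftrightarrow> A i j = 0"
proof -
  have "limit_minor w i j 0 A = (\<Prod>k\<in>minor_rows w i. limit_entry w i j 0 A k k)"
    unfolding limit_minor_def
    by (rule principal_minor_upper_triangular[OF finite_minor_rows])
       (auto simp: minor_rows_def limit_entry_def)
  thus ?thesis using assms finite_minor_rows by (auto simp: minor_rows_def limit_entry_def)
qed

lemma limit_minor_nonzero_imp_coefficients_eq_0:
  assumes w: "w permutes {1..n}" and i: "i \<in> {1..n}" and j: "j \<in> {1..n}" "j < w i"
    and nz: "limit_minor w i j 1 A \<noteq> 0"
    and other_rows: "\<And>k. k \<in> {1..n} - minor_rows w i \<Longrightarrow> x k = 0"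
    and left: "\<And>c. c < w i \<Longrightarrow> (\<Sum>k = 1..n. x k * aug_row n (2 * n) A k c) = 0"
    and k: "k \<in> {1..n}"
  shows "x k = 0"
proof (cases "k \<in> minor_rows w i")
  case True
  have "(\<Sum>k\<in>minor_rows w i. x k * limit_entry w i j 1 A k c) = 0" if c: "c \<in> minor_rows w i" for c
  proof -
    define d where "d = (if c = i then j else w c)"
    have d: "d \<in> {1..n}" "d < w i"
      using c i j permutes_in_image[OF w, of c] inj_eq[OF permutes_inj[OF w], of c i]
      by (auto simp: d_def minor_rows_def le_less)
    have "(\<Sum>k\<in>minor_rows w i. x k * limit_entry w i j 1 A k c) =
        (\<Sum>k = 1..n. x k * aug_row n (2 * n) A k d)"
      using d(1) other_rows i by (intro sum.mono_neutral_cong_left)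
        (auto simp: minor_rows_def aug_row_def limit_entry_def d_def)
    thus ?thesis using left[OF d(2)] by simp
  qed
  thus ?thesis
    using True principal_minor_nonzero_imp_left_kernel_trivial[OF finite_minor_rows
        nz[unfolded limit_minor_def]] by blast
qed (use other_rows k in blast)

lemma dim_rowspan_aug_inter_perm_interval_le:
  assumes w: "w permutes {1..n}" and i: "i \<in> {1..n}" and j: "j \<in> {1..n}" "j < w i"
    and nz: "limit_minor w i j 1 A \<noteq> 0"
  shows "cv.dim (rowspan_aug n (2 * n) A \<inter> coord_span (perm_interval n w i)) \<le>
    card {k \<in> {1..i}. w i < w k}"
proof -
  let ?W = "rowspan_aug n (2 * n) A \<inter> coord_span (perm_interval n w i)"
    and ?L = "{k \<in> {1..i}. w i < w k}"
  have "cv.dim ?W \<le> card ((+) n ` ?L)"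
  proof (rule dim_le_card_if_determined_by_coords)
    show "cv.subspace ?W"
      unfolding rowspan_aug_eq_span
      by (intro cv.subspace_inter subspace_coord_span cv.subspace_span)
    fix v assume v: "v \<in> ?W" and v_upper: "\<And>x. x \<in> (+) n ` ?L \<Longrightarrow> v x = 0"
    obtain x where x: "\<And>c. v c = (\<Sum>k = 1..n. x k * aug_row n (2 * n) A k c)"
      using v span_family_iff[OF finite_atLeastAtMost] unfolding rowspan_aug_eq_span by blast
    have outside: "v c = 0" if "c \<notin> {w i..i + n}" for c
      using v that by (auto simp: perm_interval_def coord_span_eq)
    have coefficient_eq: "x k = v (n + k)" if "k \<in> {1..n}" for k
      using sum_aug_row_right_block[OF that, of x "2 * n" A] by (simp add: x)
    have "x k = 0" if k: "k \<in> {1..n} - minor_rows w i" for k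
    proof (cases "k \<le> i")
      case True
      hence "k \<in> ?L" using k by (auto simp: minor_rows_def)
      thus ?thesis using coefficient_eq k v_upper by simp
    qed (use coefficient_eq k outside in simp)
    moreover have "(\<Sum>k = 1..n. x k * aug_row n (2 * n) A k c) = 0" if "c < w i" for c
      using outside[of c] that by (simp add: x)
    ultimately have "x k = 0" if "k \<in> {1..n}" for k
      using that by (rule limit_minor_nonzero_imp_coefficients_eq_0[OF w i j nz])
    thus "v = 0" by (simp add: x fun_eq_iff)
  qed simp
  thus ?thesis by (simp add: card_image)
qed

lemma card_perm_rank_subset_perm_interval:
  assumes w: "w permutes {1..n}" and i: "i \<in> {1..n}"
  shows "card {R \<in> perm_rank_set n w. R \<subseteq> perm_interval n w i} =
    Suc (card {k \<in> {1..i}. w i < w k})"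
proof -
  have "w i \<le> w k \<longleftrightarrow> k = i \<or> w i < w k" for k
    using inj_eq[OF permutes_inj[OF w]] by (auto simp: le_less)
  hence "perm_interval n w k \<subseteq> perm_interval n w i \<longleftrightarrow> (k = i \<or> w i < w k) \<and> k \<le> i"
    if "k \<in> {1..n}" for k
    using perm_interval_subset_interval_iff[OF w that] by (simp add: perm_interval_def[of n w i])
  hence "{k \<in> {1..n}. perm_interval n w k \<subseteq> perm_interval n w i} =
      {k \<in> {1..n}. (k = i \<or> w i < w k) \<and> k \<le> i}"
    by blast
  also have "\<dots> = insert i {k \<in> {1..i}. w i < w k}" using i by auto
  finally have "card {k \<in> {1..n}. perm_interval n w k \<subseteq> perm_interval n w i} =
      Suc (card {k \<in> {1..i}. w i < w k})" by simp
  thus ?thesis by (simp add: card_perm_rank_subset[OF w])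
qed

lemma perm_diagramD:
  assumes w: "w permutes {1..n}" and "(i, j) \<in> perm_diagram n w"
  shows "i \<in> {1..n}" "j \<in> {1..n}" "j < w i"
  using assms(2) permutes_in_image[OF w] by (auto simp: perm_diagram_def)

lemma limit_minor_eq_0_if_generic:
  assumes w: "w permutes {1..n}" and ij: "(i, j) \<in> perm_diagram n w"
    and V: "rowspan_aug n (2 * n) A \<in> generic_subspaces (2 * n) (perm_rank_set n w)"
  shows "limit_minor w i j 1 A = 0"
proof (rule ccontr)
  let ?V = "rowspan_aug n (2 * n) A" and ?S = "perm_interval n w i"
  note i = perm_diagramD(1)[OF w ij]
  assume "limit_minor w i j 1 A \<noteq> 0"
  hence "cv.dim (?V \<inter> coord_span ?S) \<le> card {k \<in> {1..i}. w i < w k}"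
    by (rule dim_rowspan_aug_inter_perm_interval_le[OF w perm_diagramD[OF w ij]])
  moreover have "?S \<in> perm_rank_set n w" using i by (simp add: perm_rank_set_eq_image)
  hence "cv.dim (?V \<inter> coord_span (?S \<inter> ?S)) = card {R \<in> perm_rank_set n w. R \<subseteq> ?S \<inter> ?S}"
    using V unfolding generic_subspaces_def by blast
  ultimately show False by (simp add: card_perm_rank_subset_perm_interval[OF w i])
qed

lemma limit_minor_form:
  assumes w: "w permutes {1..n}" and ij: "(i, j) \<in> perm_diagram n w"
  obtains d f where "f \<in> family_forms n (2 * n) d"
    "\<And>t V. V \<subseteq> coord_span {1..2 * n} \<Longrightarrow>
      vanishes_at n (f t) V \<longleftrightarrow> (\<forall>A. V = rowspan_aug n (2 * n) A \<longrightarrow> limit_minor w i j t A = 0)"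
  by (rule chart_functions_form[OF _ limit_minor_chart_function[OF w perm_diagramD(1,2)[OF w ij]]])
    auto

lemma limit_minor_eq_0_if_rank_variety:
  assumes w: "w permutes {1..n}" and ij: "(i, j) \<in> perm_diagram n w"
    and V: "rowspan_aug n (2 * n) A \<in> rank_variety (2 * n) (perm_rank_set n w)"
  shows "limit_minor w i j 1 A = 0"
proof -
  obtain d f where f: "f \<in> family_forms n (2 * n) d" and
    f_iff: "\<And>t V. V \<subseteq> coord_span {1..2 * n} \<Longrightarrow>
      vanishes_at n (f t) V \<longleftrightarrow> (\<forall>A. V = rowspan_aug n (2 * n) A \<longrightarrow> limit_minor w i j t A = 0)"
    by (rule limit_minor_form[OF w ij]) auto
  have "vanishes_at n (f 1) U" if U: "U \<in> generic_subspaces (2 * n) (perm_rank_set n w)" for U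
  proof -
    have "U \<subseteq> coord_span {1..2 * n}" using U by (simp add: generic_subspaces_def Gr_def)
    thus ?thesis using f_iff limit_minor_eq_0_if_generic[OF w ij] U by blast
  qed
  hence "vanishes_at n (f 1) (rowspan_aug n (2 * n) A)"
    by (rule vanishes_at_rank_variety[OF _ _ V, unfolded card_perm_rank_set[OF w],
          OF family_forms_specialise[OF f]])
  moreover have "rowspan_aug n (2 * n) A \<subseteq> coord_span {1..2 * n}"
    using V rank_variety_subset_Gr by (auto simp: Gr_def)
  ultimately show ?thesis using f_iff by blast
qed

definition shifted_rank_variety ::
    "nat \<Rightarrow> (nat \<Rightarrow> nat) \<Rightarrow> complex \<Rightarrow> (nat \<Rightarrow> complex) set set" where
  "shifted_rank_variety n w t =
     (\<lambda>V. perm_shift_map n t w ` V) ` rank_variety (2 * n) (perm_rank_set n w)"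

definition limit_locus :: "nat \<Rightarrow> (nat \<Rightarrow> nat) \<Rightarrow> (nat \<Rightarrow> complex) set set" where
  "limit_locus n w = zero_locus n (2 * n) (flat_limit n (2 * n) (shifted_rank_variety n w))"

lemma shifted_rank_variety_subset_coord_span:
  assumes w: "w permutes {1..n}" and "V \<in> shifted_rank_variety n w t"
  shows "V \<subseteq> coord_span {1..2 * n}"
proof -
  obtain U where U: "U \<in> rank_variety (2 * n) (perm_rank_set n w)" "V = perm_shift_map n t w ` U"
    using assms(2) by (auto simp: shifted_rank_variety_def)
  have "U \<subseteq> coord_span {1..2 * n}" using U(1) rank_variety_subset_Gr by (auto simp: Gr_def)
  thus ?thesis unfolding U(2) by (rule perm_shift_map_coord_span[OF w])
qed

lemma limit_minor_eq_0_if_shifted_rank_variety: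
  assumes w: "w permutes {1..n}" and ij: "(i, j) \<in> perm_diagram n w" and "t \<noteq> 0"
    and V: "rowspan_aug n (2 * n) B \<in> shifted_rank_variety n w t"
  shows "limit_minor w i j t B = 0"
proof -
  obtain U where U: "U \<in> rank_variety (2 * n) (perm_rank_set n w)"
      "perm_shift_map n t w ` U = rowspan_aug n (2 * n) B"
    using V by (auto simp: shifted_rank_variety_def)
  obtain A where "U = rowspan_aug n (2 * n) A" "B = shift_matrix w t A"
    using perm_shift_map_image_eq_rowspan_aug[OF w \<open>t \<noteq> 0\<close> U(2)] .
  thus ?thesis
    using U(1) limit_minor_shift_matrix[OF w \<open>t \<noteq> 0\<close> ij] limit_minor_eq_0_if_rank_variety[OF w ij]
    by simp
qed

lemma limit_locus_entry_eq_0: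
  assumes w: "w permutes {1..n}" and ij: "(i, j) \<in> perm_diagram n w"
    and V: "rowspan_aug n (2 * n) A \<in> limit_locus n w"
  shows "A i j = 0"
proof -
  obtain d f where f: "f \<in> family_forms n (2 * n) d" and
    f_iff: "\<And>t V. V \<subseteq> coord_span {1..2 * n} \<Longrightarrow>
      vanishes_at n (f t) V \<longleftrightarrow> (\<forall>A. V = rowspan_aug n (2 * n) A \<longrightarrow> limit_minor w i j t A = 0)"
    by (rule limit_minor_form[OF w ij]) auto
  have "vanishes_at n (f t) U" if "t \<noteq> 0" "U \<in> shifted_rank_variety n w t" for t U
    using that f_iff[OF shifted_rank_variety_subset_coord_span[OF w that(2)]]
      limit_minor_eq_0_if_shifted_rank_variety[OF w ij] by blast
  hence "f 0 \<in> flat_limit n (2 * n) (shifted_rank_variety n w)"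
    using f unfolding flat_limit_def by blast
  hence "vanishes_at n (f 0) (rowspan_aug n (2 * n) A)" "rowspan_aug n (2 * n) A \<in> Gr n (2 * n)"
    using V by (auto simp: limit_locus_def zero_locus_def)
  hence "limit_minor w i j 0 A = 0" using f_iff by (auto simp: Gr_def)
  thus ?thesis using limit_minor_0_eq_0_iff perm_diagramD(1)[OF w ij] by simp
qed

lemma limit_locus_Int_chart_subset_diagram_variety:
  assumes "w permutes {1..n}"
  shows "limit_locus n w \<inter> chart n (2 * n) \<subseteq> diagram_variety n (2 * n) (perm_diagram n w)"
proof
  fix V assume V: "V \<in> limit_locus n w \<inter> chart n (2 * n)"
  then obtain A where A: "V = rowspan_aug n (2 * n) A" by (auto simp: chart_def)
  show "V \<in> diagram_variety n (2 * n) (perm_diagram n w)"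
    unfolding A using V limit_locus_entry_eq_0[OF assms]
    by (intro rowspan_aug_in_diagram_variety) (auto simp: A)
qed


section \<open>Points of the flat limit\<close>

text \<open>\<open>\<phi>\<^bsub>t,w\<^esub>\<close> maps the family \<open>perm_unshift_map n t w \<circ> limit_curve n w A t\<close> to a multiple of
  \<open>limit_curve n w A t = [C | B]\<close>. Left of \<open>w(i)\<close>, the entries of row \<open>i\<close> of the former have to
  vanish, hence the entries \<open>t A\<close> of its image must there come from the off-diagonal entries of \<open>B\<close>;
  this is possible exactly outside the diagram of \<open>w\<close>.\<close>

definition limit_curve ::
    "nat \<Rightarrow> (nat \<Rightarrow> nat) \<Rightarrow> (nat \<Rightarrow> nat \<Rightarrow> complex) \<Rightarrow> complex \<Rightarrow> nat \<Rightarrow> nat \<Rightarrow> complex" where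
  "limit_curve n w A t i x =
     (if x \<in> {1..n} then if w i \<le> x then A i x else (1 - t) * A i x
      else if x = n + i then 1
      else if x \<in> {n + 1..<n + i} \<and> w (x - n) < w i then t * A i (w (x - n)) else 0)"

lemma polynomial_curve_limit_curve: "polynomial_curve n (limit_curve n w A)"
  unfolding polynomial_curve_def limit_curve_def by (intro ballI allI poly_function_intros)

lemma limit_curve_0: "limit_curve n w A 0 = aug_row n (2 * n) A"
  by (auto simp: limit_curve_def aug_row_def fun_eq_iff)

lemma unshifted_limit_curve_supported:
  assumes w: "w permutes {1..n}" and A: "\<And>i j. (i, j) \<in> perm_diagram n w \<Longrightarrow> A i j = 0"
  shows "(\<lambda>i. perm_unshift_map n t w (limit_curve n w A t i))
    \<in> supported_families {1..n} (perm_interval n w)"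
  unfolding supported_families_def perm_interval_def
proof (intro CollectI ballI allI impI)
  fix i x assume i: "i \<in> {1..n}" and x: "x \<notin> {w i..i + n}"
  have w_i: "w i \<in> {1..n}" using permutes_in_image[OF w] i by simp
  show "perm_unshift_map n t w (limit_curve n w A t i) x = 0"
  proof (cases "x \<in> {1..n}")
    case True
    define k where "k = inv_into UNIV w x"
    have k: "k \<in> {1..n}" "w k = x"
      using permutes_in_image[OF permutes_inv[OF w], of x] permutes_inverses[OF w] True
      by (auto simp: k_def)
    have "x < w i" using True x i by auto
    hence "k \<noteq> i" using k(2) by auto
    have "A i x = 0" if "i < k"
    proof (rule A)
      show "(i, x) \<in> perm_diagram n w"
        unfolding perm_diagram_def using i k that \<open>x < w i\<close> by blast
    qed
    thus ?thesis
      using True k \<open>x < w i\<close> \<open>k \<noteq> i\<close>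
      by (cases "k < i") (auto simp: perm_unshift_map_def limit_curve_def k_def[symmetric])
  next
    case False
    hence "x \<noteq> n + i" "x \<notin> {n + 1..<n + i}" using x w_i by auto
    thus ?thesis using False by (auto simp: perm_unshift_map_def limit_curve_def)
  qed
qed

lemma independent_unshifted_limit_curve:
  "independent_family {1..n} (\<lambda>i. perm_unshift_map n t w (limit_curve n w A t i))"
proof (rule independent_family_if_minor_nonzero[where e = "(+) n"])
  let ?f = "\<lambda>i j. perm_unshift_map n t w (limit_curve n w A t i) (n + j)"
  have "principal_minor {1..n} ?f = principal_minor {1..n} (\<lambda>i j. ?f j i)"
    by (rule principal_minor_transpose[symmetric])
  also have "\<dots> = (\<Prod>k = 1..n. ?f k k)"
    by (rule principal_minor_upper_triangular) (auto simp: perm_unshift_map_def limit_curve_def)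
  also have "\<dots> = 1"
    by (rule prod.neutral) (auto simp: perm_unshift_map_def limit_curve_def)
  finally show "principal_minor {1..n} ?f \<noteq> 0" by simp
qed simp

lemma limit_curve_in_shifted_rank_variety:
  assumes w: "w permutes {1..n}" and A: "\<And>i j. (i, j) \<in> perm_diagram n w \<Longrightarrow> A i j = 0"
    and "t \<noteq> 0"
  shows "cv.span (limit_curve n w A t ` {1..n}) \<in> shifted_rank_variety n w t"
proof -
  let ?v = "\<lambda>i. perm_unshift_map n t w (limit_curve n w A t i)"
  have "cv.span (?v ` {1..n}) \<in> rank_variety (2 * n) (perm_rank_set n w)"
    using unshifted_limit_curve_supported[OF w A] independent_unshifted_limit_curve
    by (rule supported_span_in_rank_variety[OF w])
  moreover have "perm_shift_map n t w ` cv.span (?v ` {1..n}) =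
      cv.span (limit_curve n w A t ` {1..n})"
    by (simp only: perm_shift_map_span[OF w] perm_shift_map_unshift[OF w]
        span_scaled_family[OF \<open>t \<noteq> 0\<close>])
  ultimately show ?thesis unfolding shifted_rank_variety_def by (metis imageI)
qed

lemma rowspan_aug_in_limit_locus:
  assumes w: "w permutes {1..n}" and A: "\<And>i j. (i, j) \<in> perm_diagram n w \<Longrightarrow> A i j = 0"
  shows "rowspan_aug n (2 * n) A \<in> limit_locus n w"
proof -
  let ?u = "limit_curve n w A"
  have "vanishes_at n g (rowspan_aug n (2 * n) A)"
    if g: "g \<in> flat_limit n (2 * n) (shifted_rank_variety n w)" for g
  proof -
    obtain d f where f: "f \<in> family_forms n (2 * n) d" "g = f 0"
      "\<And>t V. t \<noteq> 0 \<Longrightarrow> V \<in> shifted_rank_variety n w t \<Longrightarrow> vanishes_at n (f t) V"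
      using g unfolding flat_limit_def by blast
    have "f t (pluecker n (?u t)) = 0" if "t \<noteq> 0" for t
    proof -
      have "cv.span (?u t ` {1..n}) \<in> shifted_rank_variety n w t"
        using w A that by (rule limit_curve_in_shifted_rank_variety)
      thus ?thesis using f(3)[OF that] unfolding vanishes_at_def by blast
    qed
    hence "f 0 (pluecker n (?u 0)) = 0"
      by (rule poly_function_eq_0_if_generically_0[OF poly_function_id
          poly_function_family_form_along_curve[OF f(1) polynomial_curve_limit_curve] _
          one_neq_zero])
    thus ?thesis
      unfolding f(2) limit_curve_0
        vanishes_at_iff[OF family_forms_specialise[OF f(1)] rowspan_aug_eq_span[symmetric]] .
  qed
  thus ?thesis
    using rowspan_aug_in_Gr[of n "2 * n" A] by (simp add: limit_locus_def zero_locus_def)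
qed

lemma closedin_limit_locus: "closedin (zariski n (2 * n)) (limit_locus n w)"
  unfolding limit_locus_def by (rule closedin_zero_locus_flat_limit)

lemma diagram_variety_subset_limit_locus:
  assumes "w permutes {1..n}"
  shows "diagram_variety n (2 * n) (perm_diagram n w) \<subseteq> limit_locus n w"
  by (rule diagram_variety_subsetI[OF closedin_limit_locus rowspan_aug_in_limit_locus[OF assms]])

theorem theorem5p5:
  fixes n :: nat and w :: "nat \<Rightarrow> nat"
  assumes "w permutes {1..n}"
  shows "irreducible_component_of
    (scheme_space n (2 * n)
      (flat_limit n (2 * n)
        (\<lambda>t. (\<lambda>V. perm_shift_map n t w ` V) ` rank_variety (2 * n) (perm_rank_set n w))))
    (diagram_variety n (2 * n) (perm_diagram n w))"
  unfolding scheme_space_def shifted_rank_variety_def[symmetric] limit_locus_def[symmetric]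
proof (rule irreducible_component_if_open_part)
  let ?Z = "zariski n (2 * n)" and ?X = "diagram_variety n (2 * n) (perm_diagram n w)"
  have n_le_2n: "n \<le> 2 * n" by simp
  show "limit_locus n w \<subseteq> topspace ?Z" by (rule closedin_subset[OF closedin_limit_locus])
  show "?X \<subseteq> limit_locus n w" using assms by (rule diagram_variety_subset_limit_locus)
  show "closedin ?Z ?X" by (rule closedin_diagram_variety)
  show "irreducible_space (subtopology ?Z ?X)" using n_le_2n by (rule irreducible_diagram_variety)
  show "openin ?Z (chart n (2 * n))" using n_le_2n by (rule openin_chart)
  show "limit_locus n w \<inter> chart n (2 * n) \<subseteq> ?X"
    using assms by (rule limit_locus_Int_chart_subset_diagram_variety)
  show "?X \<inter> chart n (2 * n) \<noteq> {}" using n_le_2n by (rule diagram_variety_meets_chart)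
qed

end
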